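(* Given an oriented graph $G$ on $n$ vertices together with a directed clique-width $k$-expression defining $G$, and a positive integer $r$, one can decide whether $G$ has an oriented $r$-coloring (i.e. solve the Oriented Chromatic Number problem) in time $O(n\cdot k^2\cdot 2^{r(r+k)})$.
   Context: An oriented graph is a digraph with no loops and no pair of opposite arcs. An oriented $r$-coloring of an oriented graph $G=(V,E)$ is a map $c:V\to\{1,\dots,r\}$ with $c(u)\neq c(v)$ for every $(u,v)\in E$, and $c(u)\neq c(y)$ for every two arcs $(u,v),(x,y)\in E$ with $c(v)=c(x)$. A directed clique-width $k$-expression is an expression using at most $k$ labels built from the operations: creation of a new vertex $v$ with label $a$; disjoint union of two labeled digraphs; $\alpha_{a,b}$ ($a\neq b$): insert an arc from every vertex with label $a$ to every vertex with label $b$; $\rho_{a\to b}$: change every label $a$ into label $b$; it defines the digraph obtained after forgetting labels.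
   Formalization: The time bound is proved for k-expressions with at most d·n·k² operations, for any fixed constant d (the O-constant depends on d); without this, redundant operations make the expression arbitrarily long and it cannot be read within the stated time. *)

theory Defs
  imports "Graph_Theory.Pair_Digraph"
begin

section \<open>Oriented graphs and oriented colorings\<close>

definition oriented_graph :: "'a pair_pre_digraph \<Rightarrow> bool" where
  "oriented_graph G \<longleftrightarrow>
     pair_digraph G \<and> (\<forall>u v. (u, v) \<in> parcs G \<longrightarrow> (v, u) \<notin> parcs G)"

definition oriented_coloring :: "'a pair_pre_digraph \<Rightarrow> nat \<Rightarrow> ('a \<Rightarrow> nat) \<Rightarrow> bool" where
  "oriented_coloring G r c \<longleftrightarrow>
     (\<forall>v \<in> pverts G. c v \<in> {1..r}) \<and>
     (\<forall>(u, v) \<in> parcs G. c u \<noteq> c v) \<and>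
     (\<forall>(u, v) \<in> parcs G. \<forall>(x, y) \<in> parcs G. c v = c x \<longrightarrow> c u \<noteq> c y)"

section \<open>Directed clique-width expressions\<close>

datatype dcw =
    Create nat nat          \<comment> \<open>vertex, label\<close>
  | Disj dcw dcw
  | Insert_Arcs nat nat dcw
  | Relabel nat nat dcw

text \<open>The labelling is meaningful only on the vertices of the graph.\<close>

fun dcw_graph :: "dcw \<Rightarrow> nat pair_pre_digraph"
  and dcw_label :: "dcw \<Rightarrow> nat \<Rightarrow> nat" where
  "dcw_graph (Create v a) = \<lparr> pverts = {v}, parcs = {} \<rparr>"
| "dcw_graph (Disj X Y) =
     \<lparr> pverts = pverts (dcw_graph X) \<union> pverts (dcw_graph Y),
       parcs = parcs (dcw_graph X) \<union> parcs (dcw_graph Y) \<rparr>"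
| "dcw_graph (Insert_Arcs a b X) =
     \<lparr> pverts = pverts (dcw_graph X),
       parcs = parcs (dcw_graph X) \<union>
         {(u, v). u \<in> pverts (dcw_graph X) \<and> v \<in> pverts (dcw_graph X) \<and>
                  dcw_label X u = a \<and> dcw_label X v = b} \<rparr>"
| "dcw_graph (Relabel a b X) = dcw_graph X"
| "dcw_label (Create v a) = (\<lambda>_. a)"
| "dcw_label (Disj X Y) =
     (\<lambda>v. if v \<in> pverts (dcw_graph X) then dcw_label X v else dcw_label Y v)"
| "dcw_label (Insert_Arcs a b X) = dcw_label X"
| "dcw_label (Relabel a b X) = (\<lambda>v. if dcw_label X v = a then b else dcw_label X v)"

text \<open>Expressions over the labels \<open>1, \<dots>, k\<close> in which every union is disjoint.\<close>

fun dcw_expression :: "nat \<Rightarrow> dcw \<Rightarrow> bool" where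
  "dcw_expression k (Create v a) \<longleftrightarrow> a \<in> {1..k}"
| "dcw_expression k (Disj X Y) \<longleftrightarrow>
     dcw_expression k X \<and> dcw_expression k Y \<and>
     pverts (dcw_graph X) \<inter> pverts (dcw_graph Y) = {}"
| "dcw_expression k (Insert_Arcs a b X) \<longleftrightarrow>
     a \<in> {1..k} \<and> b \<in> {1..k} \<and> a \<noteq> b \<and> dcw_expression k X"
| "dcw_expression k (Relabel a b X) \<longleftrightarrow>
     a \<in> {1..k} \<and> b \<in> {1..k} \<and> dcw_expression k X"

fun dcw_ops :: "dcw \<Rightarrow> nat" where
  "dcw_ops (Create v a) = 1"
| "dcw_ops (Disj X Y) = dcw_ops X + dcw_ops Y + 1"
| "dcw_ops (Insert_Arcs a b X) = dcw_ops X + 1"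
| "dcw_ops (Relabel a b X) = dcw_ops X + 1"

section \<open>A unit-cost random access machine\<close>

text \<open>
  Structured programs for a random access machine whose registers and memory cells hold
  natural numbers. Arithmetic is restricted to addition and truncated subtraction: with
  multiplication at unit cost, the running time would not be a realistic measure.
  A state consists of the register contents and the memory contents.
\<close>

type_synonym ram_state = "(nat \<Rightarrow> nat) \<times> (nat \<Rightarrow> nat)"

datatype ram =
    Skip
  | Const nat nat           \<comment> \<open>target, value\<close>
  | Add nat nat nat         \<comment> \<open>target, operands\<close>
  | Sub nat nat nat         \<comment> \<open>target, operands\<close>
  | Load nat nat            \<comment> \<open>target, register holding the address\<close>
  | Store nat nat           \<comment> \<open>register holding the address, source\<close>
  | Seq ram ram
  | If_Less nat nat ram ram
  | While_Less nat nat ram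

text \<open>
  \<open>ram_exec P s t s'\<close>: started in \<open>s\<close>, the program \<open>P\<close> halts in \<open>s'\<close> after exactly \<open>t\<close>
  steps; every elementary instruction and every evaluation of a test is one step.
\<close>

inductive ram_exec :: "ram \<Rightarrow> ram_state \<Rightarrow> nat \<Rightarrow> ram_state \<Rightarrow> bool" where
  Skip: "ram_exec Skip s 1 s"
| Const: "ram_exec (Const x n) (R, M) 1 (R(x := n), M)"
| Add: "ram_exec (Add x y z) (R, M) 1 (R(x := R y + R z), M)"
| Sub: "ram_exec (Sub x y z) (R, M) 1 (R(x := R y - R z), M)"
| Load: "ram_exec (Load x y) (R, M) 1 (R(x := M (R y)), M)"
| Store: "ram_exec (Store x y) (R, M) 1 (R, M(R x := R y))"
| Seq: "ram_exec P s t s' \<Longrightarrow> ram_exec Q s' t' s'' \<Longrightarrow> ram_exec (Seq P Q) s (t + t') s''"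
| If_True: "fst s x < fst s y \<Longrightarrow> ram_exec P s t s' \<Longrightarrow>
    ram_exec (If_Less x y P Q) s (t + 1) s'"
| If_False: "\<not> fst s x < fst s y \<Longrightarrow> ram_exec Q s t s' \<Longrightarrow>
    ram_exec (If_Less x y P Q) s (t + 1) s'"
| While_False: "\<not> fst s x < fst s y \<Longrightarrow> ram_exec (While_Less x y P) s 1 s"
| While_True: "fst s x < fst s y \<Longrightarrow> ram_exec P s t s' \<Longrightarrow>
    ram_exec (While_Less x y P) s' t' s'' \<Longrightarrow>
    ram_exec (While_Less x y P) s (t + t' + 1) s''"

inductive_cases ram_exec_SkipE: "ram_exec Skip s t s'"
inductive_cases ram_exec_ConstE: "ram_exec (Const x n) s t s'"
inductive_cases ram_exec_AddE: "ram_exec (Add x y z) s t s'"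
inductive_cases ram_exec_SubE: "ram_exec (Sub x y z) s t s'"
inductive_cases ram_exec_LoadE: "ram_exec (Load x y) s t s'"
inductive_cases ram_exec_StoreE: "ram_exec (Store x y) s t s'"
inductive_cases ram_exec_SeqE: "ram_exec (Seq P Q) s t s'"
inductive_cases ram_exec_IfE: "ram_exec (If_Less x y P Q) s t s'"
inductive_cases ram_exec_WhileE: "ram_exec (While_Less x y P) s t s'"

lemma ram_exec_deterministic:
  "ram_exec P s t s' \<Longrightarrow> ram_exec P s u s'' \<Longrightarrow> u = t \<and> s'' = s'"
proof (induction arbitrary: u s'' rule: ram_exec.induct)
  case (Seq P s t s' Q t' s2)
  from Seq.prems obtain t1 s1 t2 where "ram_exec P s t1 s1" "ram_exec Q s1 t2 s''" "u = t1 + t2"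
    by (rule ram_exec_SeqE)
  then show ?case using Seq.IH by metis
next
  case (If_True s x y P t s' Q)
  from If_True.prems If_True.hyps(1) obtain t1 where "ram_exec P s t1 s''" "u = t1 + 1"
    by (auto elim: ram_exec_IfE)
  then show ?case using If_True.IH by metis
next
  case (If_False s x y Q t s' P)
  from If_False.prems If_False.hyps(1) obtain t1 where "ram_exec Q s t1 s''" "u = t1 + 1"
    by (auto elim: ram_exec_IfE)
  then show ?case using If_False.IH by metis
next
  case (While_False s x y P)
  from While_False.prems show ?case
    by (rule ram_exec_WhileE) (use While_False.hyps in simp_all)
next
  case (While_True s x y P t s' t' s2)
  from While_True.prems obtain t1 s1 t2 where "ram_exec P s t1 s1"
    "ram_exec (While_Less x y P) s1 t2 s''" "u = t1 + t2 + 1"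
    by (rule ram_exec_WhileE) (use While_True.hyps(1) in simp_all)
  then show ?case using While_True.IH by metis
qed (erule ram_exec_SkipE ram_exec_ConstE ram_exec_AddE ram_exec_SubE
       ram_exec_LoadE ram_exec_StoreE; simp)+

section \<open>Presenting an instance to the machine\<close>

text \<open>Postfix notation, three memory cells for each operation.\<close>

fun dcw_code :: "dcw \<Rightarrow> nat list" where
  "dcw_code (Create v a) = [0, v, a]"
| "dcw_code (Disj X Y) = dcw_code X @ dcw_code Y @ [1, 0, 0]"
| "dcw_code (Insert_Arcs a b X) = dcw_code X @ [2, a, b]"
| "dcw_code (Relabel a b X) = dcw_code X @ [3, a, b]"

definition ram_input :: "nat list \<Rightarrow> ram_state" where
  "ram_input xs = (\<lambda>_. 0, \<lambda>i. if i < length xs then xs ! i else 0)"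

definition ram_output :: "ram_state \<Rightarrow> nat" where
  "ram_output s = fst s 0"

definition instance_code :: "nat \<Rightarrow> nat \<Rightarrow> dcw \<Rightarrow> nat list" where
  "instance_code r k X = [r, k, dcw_ops X] @ dcw_code X"

end

theory Submission
  imports Defs
begin

text \<open>
  An oriented \<open>r\<close>-colouring is a homomorphism into some tournament on the \<open>r\<close> colours. For every
  subexpression \<open>X\<close> a table is kept that tells, for every tournament and every set \<open>F\<close> of pairs
  (label, colour), whether \<open>X\<close> has a homomorphism into the tournament that uses \<^emph>\<open>only\<close> pairs
  from \<open>F\<close>. Allowing subsets of \<open>F\<close> turns disjoint union into the pointwise conjunction of two tables.
  Inserting arcs from \<open>a\<close> to \<open>b\<close> imposes, for every non-arc \<open>(i, j)\<close> of the tournament, that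
  \<open>(a, i)\<close> and \<open>(b, j)\<close> are not both used: the entry at an \<open>F\<close> containing both becomes the disjunction
  of the entries at \<open>F\<close> without the first and \<open>F\<close> without the second. Relabelling \<open>a\<close> to \<open>b\<close> reads the
  entry in which row \<open>a\<close> of \<open>F\<close> is replaced by row \<open>b\<close>.

  With \<open>r (r - 1)\<close> bits for the tournament a table has \<open>2 ^ (r (r + k) - r)\<close> entries, and an operation
  makes \<open>r\<^sup>2\<close> passes over it; as \<open>r\<^sup>2 \<le> 2 * 2 ^ r\<close>, this is \<open>O(2 ^ (r (r + k)))\<close> per operation.
\<close>

section \<open>Time-bounded total correctness\<close>

text \<open>Only an upper bound \<open>T\<close> is kept, so the exact step counts of
  \<open>ram_exec\<close> may be rounded up at every composition.\<close>

definition halts_within :: "ram \<Rightarrow> ram_state \<Rightarrow> nat \<Rightarrow> (ram_state \<Rightarrow> bool) \<Rightarrow> bool" where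
  "halts_within P s T Q \<longleftrightarrow> (\<exists>t s'. ram_exec P s t s' \<and> t \<le> T \<and> Q s')"

lemma halts_within_mono:
  assumes "halts_within P s T Q" "T \<le> T'" "\<And>s'. Q s' \<Longrightarrow> Q' s'"
  shows "halts_within P s T' Q'"
  using assms unfolding halts_within_def by (meson le_trans)

lemma halts_within_Seq:
  assumes "halts_within P s T Q'" "\<And>s'. Q' s' \<Longrightarrow> halts_within P' s' T' Q" "T + T' \<le> T''"
  shows "halts_within (Seq P P') s T'' Q"
proof -
  obtain t s1 t' s2 where "ram_exec P s t s1" "t \<le> T" "ram_exec P' s1 t' s2" "t' \<le> T'" "Q s2"
    using assms(1,2) unfolding halts_within_def by blast
  moreover from this have "ram_exec (Seq P P') s (t + t') s2" by (blast intro: ram_exec.Seq)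
  ultimately show ?thesis using assms(3) unfolding halts_within_def by (meson add_mono le_trans)
qed

lemma halts_within_If:
  assumes "fst s x < fst s y \<Longrightarrow> halts_within P s T Q"
    and "\<not> fst s x < fst s y \<Longrightarrow> halts_within P' s T Q"
  shows "halts_within (If_Less x y P P') s (T + 1) Q"
proof (cases "fst s x < fst s y")
  case True
  then obtain t s' where "ram_exec P s t s'" "t \<le> T" "Q s'"
    using assms(1) unfolding halts_within_def by blast
  then show ?thesis using ram_exec.If_True[OF True] unfolding halts_within_def
    by (meson add_le_mono1)
next
  case False
  then obtain t s' where "ram_exec P' s t s'" "t \<le> T" "Q s'"
    using assms(2) unfolding halts_within_def by blast
  then show ?thesis using ram_exec.If_False[OF False] unfolding halts_within_def
    by (meson add_le_mono1)
qed

text \<open>The rest of the loop is the postcondition of its first iteration. In this continuation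
  form \<open>eval_prog\<close> can be followed by recursion on the expression.\<close>

lemma halts_within_While_unfold:
  assumes "fst s x < fst s y"
    and "halts_within P s T (\<lambda>s'. halts_within (While_Less x y P) s' T' Q)"
    and "T + T' + 1 \<le> T''"
  shows "halts_within (While_Less x y P) s T'' Q"
proof -
  obtain t s1 t' s2 where *: "ram_exec P s t s1" "t \<le> T"
    "ram_exec (While_Less x y P) s1 t' s2" "t' \<le> T'" "Q s2"
    using assms(2) unfolding halts_within_def by blast
  then have "ram_exec (While_Less x y P) s (t + t' + 1) s2"
    using ram_exec.While_True[OF assms(1)] by blast
  moreover have "t + t' + 1 \<le> T''" using * assms(3) by linarith
  ultimately show ?thesis using *(5) unfolding halts_within_def by blast
qed

text \<open>The invariant is indexed by the number of completed iterations, which makes the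
  iteration count exactly \<open>N\<close>.\<close>

lemma halts_within_While:
  assumes "I 0 s"
    and "\<And>n s. n < N \<Longrightarrow> I n s \<Longrightarrow> fst s x < fst s y"
    and "\<And>n s. n < N \<Longrightarrow> I n s \<Longrightarrow> halts_within P s T (I (Suc n))"
    and "\<And>s. I N s \<Longrightarrow> \<not> fst s x < fst s y"
    and "\<And>s. I N s \<Longrightarrow> Q s"
    and "N * (T + 1) + 1 \<le> T'"
  shows "halts_within (While_Less x y P) s T' Q"
proof -
  \<comment> \<open>Induction on the number \<open>m\<close> of iterations still to come.\<close>
  have "m \<le> N \<Longrightarrow> I (N - m) s \<Longrightarrow> halts_within (While_Less x y P) s (m * (T + 1) + 1) Q" for m s
  proof (induction m arbitrary: s)
    case 0
    then have I: "I N s" by simp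
    then have "ram_exec (While_Less x y P) s 1 s"
      by (rule ram_exec.While_False[OF assms(4)])
    moreover have "1 \<le> 0 * (T + 1) + (1::nat)" by simp
    ultimately show ?case using assms(5)[OF I] unfolding halts_within_def by blast
  next
    case (Suc m)
    have less: "N - Suc m < N" and S: "Suc (N - Suc m) = N - m" using Suc.prems by auto
    have "halts_within P s T (I (N - m))" using assms(3)[OF less Suc.prems(2)] S by simp
    then have "halts_within P s T (\<lambda>s'. halts_within (While_Less x y P) s' (m * (T + 1) + 1) Q)"
      by (rule halts_within_mono) (use Suc in auto)
    then show ?case
      by (rule halts_within_While_unfold[OF assms(2)[OF less Suc.prems(2)]]) simp
  qed
  from this[of N s] show ?thesis using assms(1,6) by (auto intro: halts_within_mono)
qed

fun loop_free :: "ram \<Rightarrow> bool" where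
  "loop_free (Seq P Q) \<longleftrightarrow> loop_free P \<and> loop_free Q"
| "loop_free (If_Less x y P Q) \<longleftrightarrow> loop_free P \<and> loop_free Q"
| "loop_free (While_Less x y P) \<longleftrightarrow> False"
| "loop_free _ \<longleftrightarrow> True"

text \<open>On loop-free code this is an executable semantics, so simplification can run such code
  symbolically. Loops get a dummy value.\<close>

fun run :: "ram \<Rightarrow> ram_state \<Rightarrow> ram_state" where
  "run (Const x n) (R, M) = (R(x := n), M)"
| "run (Add x y z) (R, M) = (R(x := R y + R z), M)"
| "run (Sub x y z) (R, M) = (R(x := R y - R z), M)"
| "run (Load x y) (R, M) = (R(x := M (R y)), M)"
| "run (Store x y) (R, M) = (R, M(R x := R y))"
| "run (Seq P Q) s = run Q (run P s)"
| "run (If_Less x y P Q) (R, M) = (if R x < R y then run P (R, M) else run Q (R, M))"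
| "run _ s = s"

fun cost :: "ram \<Rightarrow> nat" where
  "cost (Seq P Q) = cost P + cost Q"
| "cost (If_Less x y P Q) = max (cost P) (cost Q) + 1"
| "cost _ = 1"

lemma halts_within_loop_free:
  assumes "loop_free P" "cost P \<le> T" "Q (run P s)"
  shows "halts_within P s T Q"
proof -
  have "loop_free P \<Longrightarrow> halts_within P s (cost P) (\<lambda>s'. s' = run P s)"
  proof (induction P arbitrary: s)
    case (Seq P Q)
    show ?case
    proof (rule halts_within_Seq)
      show "halts_within P s (cost P) (\<lambda>s'. s' = run P s)" using Seq by simp
      show "halts_within Q s' (cost Q) (\<lambda>s'. s' = run (Seq P Q) s)" if "s' = run P s" for s'
        using Seq that by simp
    qed simp
  next
    case (If_Less x y P Q)
    have "halts_within P s (max (cost P) (cost Q)) (\<lambda>s'. s' = run P s)"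
      "halts_within Q s (max (cost P) (cost Q)) (\<lambda>s'. s' = run Q s)"
      by (rule halts_within_mono, rule If_Less.IH; use If_Less.prems in simp)+
    then show ?case unfolding cost.simps by (cases s, intro halts_within_If) simp_all
  qed (cases s, fastforce simp: halts_within_def intro: ram_exec.intros)+
  from halts_within_mono[OF this[OF assms(1)] assms(2)] show ?thesis using assms(3) by simp
qed

section \<open>The program\<close>

text \<open>
  Table indices \<open>f\<close> are bit matrices with \<open>r\<close> columns. Row \<open>l - 1\<close> lists the colours that
  vertices of label \<open>l\<close> may use. For \<open>i < j\<close>, column \<open>i\<close> of row \<open>k - 1 + j\<close> tells whether the
  tournament on the colours has the arc \<open>(i, j)\<close> or the arc \<open>(j, i)\<close>. The machine has no shifts:
  while \<open>f\<close> runs through a table, the counters \<open>cP\<close>, \<open>cQ\<close>, \<open>cE\<close> hold \<open>f\<close> modulo twice the powers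
  of two in \<open>rP\<close>, \<open>rQ\<close>, \<open>rE\<close>, and a bit is set iff its counter has reached the power.
\<close>

abbreviation (input) "rOut \<equiv> 0 :: nat"
abbreviation (input) "rCol \<equiv> 2 :: nat"
abbreviation (input) "rLab \<equiv> 3 :: nat"
abbreviation (input) "rSiz \<equiv> 4 :: nat"
abbreviation (input) "rFin \<equiv> 5 :: nat"
abbreviation (input) "rPc \<equiv> 6 :: nat"
abbreviation (input) "rSp \<equiv> 7 :: nat"
abbreviation (input) "rOp \<equiv> 8 :: nat"
abbreviation (input) "rA \<equiv> 9 :: nat"
abbreviation (input) "rB \<equiv> 10 :: nat"
abbreviation (input) "rI \<equiv> 11 :: nat"
abbreviation (input) "rJ \<equiv> 12 :: nat"
abbreviation (input) "rP \<equiv> 13 :: nat"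
abbreviation (input) "rQ \<equiv> 14 :: nat"
abbreviation (input) "rE \<equiv> 15 :: nat"
abbreviation (input) "rW \<equiv> 16 :: nat"
abbreviation (input) "rF \<equiv> 17 :: nat"
abbreviation (input) "cP \<equiv> 18 :: nat"
abbreviation (input) "cQ \<equiv> 19 :: nat"
abbreviation (input) "cE \<equiv> 20 :: nat"
abbreviation (input) "rAd \<equiv> 21 :: nat"
abbreviation (input) "rVa \<equiv> 22 :: nat"
abbreviation (input) "rVb \<equiv> 23 :: nat"
abbreviation (input) "rRow \<equiv> 24 :: nat"
abbreviation (input) "rEx \<equiv> 25 :: nat"
abbreviation (input) "rCt \<equiv> 26 :: nat"
abbreviation (input) "rTb \<equiv> 27 :: nat"
abbreviation (input) "rZero \<equiv> 28 :: nat"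
abbreviation (input) "rTwo \<equiv> 29 :: nat"
abbreviation (input) "rThree \<equiv> 30 :: nat"
abbreviation (input) "rOne \<equiv> 31 :: nat"

fun block :: "ram list \<Rightarrow> ram" where
  "block [] = Skip"
| "block [P] = P"
| "block (P # Q # Ps) = Seq P (block (Q # Ps))"

text \<open>For want of multiplication and shifts, the exponent is accumulated by repeated addition
  and the power by repeated doubling.\<close>

definition power_prog :: "nat \<Rightarrow> nat \<Rightarrow> nat \<Rightarrow> ram" where
  "power_prog dst row col = block
     [Seq (Const rCt 0) (Add rEx col rZero),
      While_Less rCt row (Seq (Add rEx rEx rCol) (Add rCt rCt rOne)),
      Seq (Const dst 1) (Const rCt 0),
      While_Less rCt rEx (Seq (Add dst dst dst) (Add rCt rCt rOne))]"

text \<open>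
  Tables are updated in place: the entries read by an update are not changed by the same pass,
  because in their indices the bits in question do not call for an update. A union is idempotent,
  so it may be repeated for every \<open>i\<close> and \<open>j\<close>.
\<close>

definition cell_prog :: ram where
  "cell_prog = Seq (Add rAd rTb rF)
    (If_Less rOp rOne
      (If_Less cQ rQ
        (If_Less rZero rI Skip (If_Less rZero rJ Skip (Store rAd rZero)))
        (Store rAd rOne))
    (If_Less rOp rTwo
      (block [Add rVa rSp rF, Load rVa rVa, If_Less rZero rVa Skip (Store rAd rZero)])
    (If_Less rOp rThree
      (If_Less cP rP Skip (If_Less cQ rQ Skip (If_Less cE rE Skip
        (block [Sub rVa rAd rP, Load rVa rVa, Sub rVb rAd rQ, Load rVb rVb,
          If_Less rVa rVb (Store rAd rVb) (Store rAd rVa)]))))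
      (If_Less rI rJ Skip (If_Less rJ rI Skip
        (If_Less cP rP
          (If_Less cQ rQ Skip (block [Add rVa rAd rP, Load rVa rVa, Store rAd rVa]))
          (If_Less cQ rQ (block [Sub rVa rAd rP, Load rVa rVa, Store rAd rVa]) Skip)))))))"

definition counter_prog :: "nat \<Rightarrow> nat \<Rightarrow> ram" where
  "counter_prog c x = block
     [Add c c rOne, Add rVa x x, If_Less c rVa Skip (Const c 0)]"

definition pass_prog :: ram where
  "pass_prog = Seq
     (block [Const rF 0, Const cP 0, Const cQ 0, Add cE rW rZero])
     (While_Less rF rSiz
       (block [cell_prog, counter_prog cP rP, counter_prog cQ rQ, counter_prog cE rE,
         Add rF rF rOne]))"

text \<open>
  After this, the bit tested by \<open>cE\<close> says that \<open>(i, j)\<close> is not an arc. For \<open>i < j\<close> the stored bit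
  has to be negated, which is done by starting the counter at half its period; for \<open>i = j\<close> the bit
  of \<open>rP\<close> is used, which is set whenever the test matters.
\<close>

definition arc_prog :: ram where
  "arc_prog = If_Less rI rJ
     (block [Add rRow rLab rJ, power_prog rE rRow rI, Add rW rE rZero])
     (If_Less rJ rI
       (block [Add rRow rLab rI, power_prog rE rRow rJ, Const rW 0])
       (Seq (Add rE rP rZero) (Const rW 0)))"

definition step_prog :: ram where
  "step_prog = block [power_prog rP rA rI, power_prog rQ rB rJ, arc_prog, pass_prog, Add rJ rJ rOne]"

text \<open>Every kind of operation runs through all pairs of colours: creation adds one colour per
  \<open>j\<close>, union repeats itself, relabelling acts only on the diagonal.\<close>

definition nest_prog :: ram where
  "nest_prog = Seq (Const rI 0)
     (While_Less rI rCol
       (block [Const rJ 0,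
         While_Less rJ rCol step_prog,
         Add rI rI rOne]))"

text \<open>The code is postfix, so the tables form a stack: creation pushes a table, union pops
  one. \<open>rTb\<close> is the base of the top table after this change, and a popped table remains
  readable at \<open>rSp\<close>. Labels are shifted to start at 0.\<close>

definition fetch_prog :: ram where
  "fetch_prog = block
     [Load rOp rPc, Add rPc rPc rOne, Load rA rPc, Add rPc rPc rOne, Load rB rPc,
      Add rPc rPc rOne,
      If_Less rOp rOne (Seq (Add rA rB rZero) (Add rSp rSp rSiz))
        (If_Less rOp rTwo (Sub rSp rSp rSiz) Skip),
      Sub rA rA rOne, Sub rB rB rOne, Sub rTb rSp rSiz]"

definition eval_prog :: ram where
  "eval_prog = While_Less rPc rFin (Seq fetch_prog nest_prog)"

definition setup_prog :: ram where
  "setup_prog = Seq (block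
     [Const rOne 1, Const rTwo 2, Const rThree 3, Load rCol rZero, Load rLab rOne, Load rFin rTwo,
      Add rPc rFin rFin, Add rFin rFin rPc, Add rFin rFin rThree, Add rPc rThree rZero,
      Add rSp rFin rZero, Sub rLab rLab rOne, Add rRow rLab rCol, Const rVb 0])
     (power_prog rSiz rRow rVb)"

definition scan_prog :: ram where
  "scan_prog = Seq (Seq (Sub rTb rSp rSiz) (Const rF 0))
     (While_Less rF rSiz
       (block [Add rAd rTb rF, Load rAd rAd, If_Less rZero rAd (Const rOut 1) Skip,
         Add rF rF rOne]))"

definition coloring_prog :: ram where
  "coloring_prog = block [setup_prog, eval_prog, scan_prog]"

section \<open>Correctness and running time of the parts\<close>

text \<open>The residue modulo \<open>2 * 2 ^ p\<close> is bit \<open>p\<close> times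
  \<open>2 ^ p\<close> plus a number below \<open>2 ^ p\<close>, so one comparison reads the
  bit.\<close>

lemma bit_iff_counter: "bit (f::nat) p \<longleftrightarrow> \<not> f mod (2 * 2 ^ p) < 2 ^ p"
proof -
  have "f mod (2 ^ p * 2) = 2 ^ p * (f div 2 ^ p mod 2) + f mod 2 ^ p" by (rule mod_mult2_eq)
  then show ?thesis by (cases "even (f div 2 ^ p)")
    (simp_all add: bit_iff_odd mult.commute odd_iff_mod_2_eq_one)
qed

lemma bit_add_power: "bit ((f::nat) + 2 ^ e) e \<longleftrightarrow> \<not> bit f e"
  by (simp add: bit_iff_odd)

text \<open>The loops take three steps per unit of the row and of the exponent \<open>e\<close>. The
  row is at most \<open>e\<close> because there is at least one column, and
  \<open>e + 1 \<le> 2 ^ e\<close> makes the total linear in the computed power.\<close>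

lemma halts_within_power_prog:
  assumes R: "R rOne = 1" "R rZero = 0" "R rCol \<ge> 1"
    and regs: "dst \<notin> {row, col, rEx, rCt, rCol, rOne}" "row \<notin> {rEx, rCt}" "col \<notin> {rEx, rCt}"
    and e: "e = R row * R rCol + R col"
    and Q: "Q (R(rEx := e, rCt := e, dst := 2 ^ e), M)"
  shows "halts_within (power_prog dst row col) (R, M) (6 * 2 ^ e) Q"
proof -
  define n where "n = R row"
  have n: "n \<le> e" unfolding e n_def using R(3) by (simp add: trans_le_add1)
  have e2: "e + 1 \<le> 2 ^ e" by (simp add: Suc_leI)
  let ?s1 = "(R(rCt := 0, rEx := R col), M)"
  let ?s2 = "(R(rCt := n, rEx := e), M)"
  let ?s3 = "(R(rCt := 0, rEx := e, dst := 1), M)"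
  have 1: "halts_within (Seq (Const rCt 0) (Add rEx col rZero)) (R, M) 2 (\<lambda>s. s = ?s1)"
    by (rule halts_within_loop_free) (use regs R in \<open>auto\<close>)
  have 2: "halts_within (While_Less rCt row (Seq (Add rEx rEx rCol) (Add rCt rCt rOne))) ?s1
      (3 * n + 1) (\<lambda>s. s = ?s2)"
    by (rule halts_within_While[where T = 2 and N = n and
        I = "\<lambda>m s. s = (R(rCt := m, rEx := m * R rCol + R col), M)"])
      (use regs R in \<open>auto simp: n_def e fun_eq_iff intro!: halts_within_loop_free\<close>)
  have 3: "halts_within (Seq (Const dst 1) (Const rCt 0)) ?s2 2 (\<lambda>s. s = ?s3)"
    by (rule halts_within_loop_free) (use regs R in \<open>auto simp: fun_eq_iff\<close>)
  have 4: "halts_within (While_Less rCt rEx (Seq (Add dst dst dst) (Add rCt rCt rOne))) ?s3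
      (3 * e + 1) Q"
  proof (rule halts_within_While[where T = 2 and N = e and
        I = "\<lambda>m s. s = (R(rCt := m, rEx := e, dst := 2 ^ m), M)"])
    fix s assume "s = (R(rCt := e, rEx := e, dst := 2 ^ e), M)"
    moreover have "R(rCt := e, rEx := e, dst := 2 ^ e) = R(rEx := e, rCt := e, dst := 2 ^ e)"
      by auto
    ultimately show "Q s" using Q by simp
  qed (use regs R in \<open>auto simp: fun_eq_iff intro!: halts_within_loop_free\<close>)
  have "halts_within (power_prog dst row col) (R, M)
      (2 + ((3 * n + 1) + (2 + (3 * e + 1)))) Q"
    unfolding power_prog_def block.simps
    apply (rule halts_within_Seq[OF 1 _ order_refl])
    apply (erule ssubst)
    apply (rule halts_within_Seq[OF 2 _ order_refl])
    apply (erule ssubst)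
    apply (rule halts_within_Seq[OF 3 _ order_refl])
    apply (erule ssubst)
    apply (rule 4)
    done
  then show ?thesis by (rule halts_within_mono) (use n e2 in linarith)+
qed

section \<open>One pass over a table, in place\<close>

text \<open>The intended effect of a pass on the old table \<open>T\<close>, with \<open>T'\<close>
  the table above it and \<open>h\<close> the non-arc test. Positive entries mean true, so
  \<open>max\<close> is disjunction. Relabelling reads the index in which bit \<open>p\<close> is
  overwritten by bit \<open>q\<close>.\<close>

definition pass_val :: "nat \<Rightarrow> nat \<Rightarrow> nat \<Rightarrow> nat \<Rightarrow> nat \<Rightarrow> (nat \<Rightarrow> bool) \<Rightarrow> (nat \<Rightarrow> nat) \<Rightarrow>
    (nat \<Rightarrow> nat) \<Rightarrow> nat \<Rightarrow> nat" where
  "pass_val op i j p q h T T' f =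
     (if op = 0 then if bit f q then 1 else if i = 0 \<and> j = 0 then 0 else T f
      else if op = 1 then if T' f = 0 then 0 else T f
      else if op = 2 then
        if bit f p \<and> bit f q \<and> h f then max (T (f - 2 ^ p)) (T (f - 2 ^ q)) else T f
      else if i = j \<and> bit f p \<noteq> bit f q then
        if bit f p then T (f - 2 ^ p) else T (f + 2 ^ p)
      else T f)"

text \<open>The memory in the middle of a pass, when the scan has rewritten the first
  \<open>n\<close> cells of the table at \<open>b\<close>.\<close>

definition overlay :: "nat \<Rightarrow> nat \<Rightarrow> (nat \<Rightarrow> nat) \<Rightarrow> (nat \<Rightarrow> nat) \<Rightarrow> nat \<Rightarrow> nat" where
  "overlay b n U M x = (if b \<le> x \<and> x < b + n then U (x - b) else M x)"

lemma overlay_0 [simp]: "overlay b 0 U M = M"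
  by (auto simp: overlay_def fun_eq_iff)

lemma overlay_Suc: "(overlay b n U M)(b + n := U n) = overlay b (Suc n) U M"
  by (auto simp: overlay_def fun_eq_iff)

lemma overlay_noop: "U n = M (b + n) \<Longrightarrow> overlay b (Suc n) U M = overlay b n U M"
  unfolding overlay_Suc[symmetric] by (simp add: overlay_def fun_eq_iff)

lemma bit_imp_le: "bit (f::nat) p \<Longrightarrow> 2 ^ p \<le> f"
  by (meson bit_iff_counter leI le_trans mod_less_eq_dividend)

lemma bit_diff_power:
  assumes "bit (f::nat) p"
  shows "bit (f - 2 ^ p) x \<longleftrightarrow> bit f x \<and> x \<noteq> p"
proof -
  have "f = set_bit p (unset_bit p f)"
    using assms by (intro bit_eqI) (auto simp: bit_simps)
  also have "\<dots> = unset_bit p f + 2 ^ p" by (simp add: set_bit_eq bit_simps)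
  finally have "f - 2 ^ p = unset_bit p f" by simp
  then show ?thesis by (auto simp: bit_simps)
qed

lemma bit_plus_power:
  assumes "\<not> bit (f::nat) p"
  shows "bit (f + 2 ^ p) x \<longleftrightarrow> bit f x \<or> x = p"
proof -
  have "f + 2 ^ p = set_bit p f" using assms by (simp add: set_bit_eq)
  then show ?thesis by (auto simp: bit_simps)
qed

lemma run_cell_prog:
  fixes R M :: "nat \<Rightarrow> nat"
  defines "T \<equiv> \<lambda>f. M (R rTb + f)" and "T' \<equiv> \<lambda>f. M (R rSp + f)"
  assumes R: "R rOne = 1" "R rZero = 0" "R rTwo = 2" "R rThree = 3"
    and op: "R rOp \<le> 3"
    and f: "f = R rF" "f < S" "R rSp = R rTb + S"
    and bits: "R rP = 2 ^ p" "R rQ = 2 ^ q"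
      "R cP < R rP \<longleftrightarrow> \<not> bit f p" "R cQ < R rQ \<longleftrightarrow> \<not> bit f q" "R cE < R rE \<longleftrightarrow> \<not> h f"
    and U: "U = pass_val (R rOp) (R rI) (R rJ) p q h T T'"
  obtains R' where "run cell_prog (R, overlay (R rTb) f U M) = (R', overlay (R rTb) (Suc f) U M)"
    "\<And>x. x \<notin> {rAd, rVa, rVb} \<Longrightarrow> R' x = R x"
proof -
  let ?b = "R rTb"
  let ?M = "overlay ?b f U M"
  \<comment> \<open>One cell lies ahead of the scan, the other in the table above the written one;
    both still hold their old values.\<close>
  have later: "?M (?b + (f + 2 ^ p)) = T (f + 2 ^ p)"
    and other: "?M (R rSp + f) = T' f"
    using f by (auto simp: overlay_def T_def T'_def)
  define M1 where "M1 = overlay ?b (Suc f) U M"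
  have upd: "?M(?b + f := v) = M1" if "v = U f" for v
    using that by (simp add: overlay_Suc M1_def)
  have skip: "?M = M1" if "U f = T f"
    using that by (simp add: overlay_noop T_def M1_def)
  have Uf: "U f = pass_val (R rOp) (R rI) (R rJ) p q h T T' f" by (simp add: U)
  note regs = R f(1)[symmetric] bits(1,2) bits(3-5)[unfolded bits(1,2)]
  define M0 where "M0 = ?M"
  note folded = M0_def[symmetric]
  consider "R rOp = 0" | "R rOp = 1" | "R rOp = 2" | "R rOp = 3" using op by linarith
  then have "snd (run cell_prog (R, M0)) = M1 \<and>
      (\<forall>x. x \<notin> {rAd, rVa, rVb} \<longrightarrow> fst (run cell_prog (R, M0)) x = R x)"
  proof cases
    case 1
    show ?thesis
      using upd[unfolded folded] skip[unfolded folded]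
      by (cases "bit f q"; cases "R rI = 0 \<and> R rJ = 0")
        (auto simp: cell_prog_def regs 1 Uf pass_val_def)
  next
    case 2
    show ?thesis
      using upd[unfolded folded] skip[unfolded folded] other[unfolded folded]
      by (cases "T' f = 0") (auto simp: cell_prog_def regs 2 Uf pass_val_def)
  next
    case 3
    show ?thesis
    proof (cases "bit f p \<and> bit f q \<and> h f")
      case True
      \<comment> \<open>Clearing either bit disables the update, so the cells behind the scan that
        are read here were rewritten with their old values.\<close>
      have "U (f - 2 ^ p) = T (f - 2 ^ p)" "U (f - 2 ^ q) = T (f - 2 ^ q)"
        using True 3 by (auto simp: U pass_val_def bit_diff_power)
      moreover have le: "2 ^ p \<le> f" "2 ^ q \<le> f" using True by (auto simp: bit_imp_le)
      ultimately have "?M (?b + f - 2 ^ p) = T (f - 2 ^ p)" "?M (?b + f - 2 ^ q) = T (f - 2 ^ q)"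
        by (auto simp: overlay_def T_def)
      note eqs = this[unfolded folded]
      show ?thesis
        using upd[unfolded folded] True
        by (cases "T (f - 2 ^ p) < T (f - 2 ^ q)")
          (simp_all add: cell_prog_def regs 3 Uf pass_val_def eqs max_absorb1 max_absorb2)
    next
      case False
      then show ?thesis
        using upd[unfolded folded] skip[unfolded folded]
        by (auto simp: cell_prog_def regs 3 Uf pass_val_def)
    qed
  next
    case 4
    show ?thesis
    proof (cases "R rI = R rJ \<and> bit f p \<noteq> bit f q")
      case True
      show ?thesis
      proof (cases "bit f p")
        case p: True
        \<comment> \<open>Bit \<open>q\<close> is clear here, so clearing bit \<open>p\<close> makes
          the two bits agree, and the pass has left that smaller index unchanged.\<close>
        have "U (f - 2 ^ p) = T (f - 2 ^ p)"
          using True p 4 by (auto simp: U pass_val_def bit_diff_power)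
        moreover have "2 ^ p \<le> f" using p by (auto simp: bit_imp_le)
        ultimately have "?M (?b + f - 2 ^ p) = T (f - 2 ^ p)"
          by (auto simp: overlay_def T_def)
        note eqs = this[unfolded folded]
        show ?thesis
          using upd[unfolded folded] True p
          by (simp add: cell_prog_def regs 4 Uf pass_val_def eqs)
      next
        case p: False
        show ?thesis
          using upd[unfolded folded] True p
          by (simp add: cell_prog_def regs 4 Uf pass_val_def later[unfolded folded] add.assoc)
      qed
    next
      case False
      then show ?thesis
        using skip[unfolded folded]
        by (auto simp: cell_prog_def regs 4 Uf pass_val_def)
    qed
  qed
  then show ?thesis unfolding M1_def M0_def
    by (intro that[of "fst (run cell_prog (R, ?M))"]) (auto simp: prod_eq_iff)
qed

lemma run_counter_prog:
  assumes "R rOne = 1" "R x = 2 ^ p" "R c = f mod (2 * 2 ^ p)" "c \<noteq> rVa" "c \<noteq> rOne" "c \<noteq> x" "x \<noteq> rVa"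
  shows "run (counter_prog c x) (R, M) = (R(rVa := 2 * 2 ^ p, c := Suc f mod (2 * 2 ^ p)), M)"
proof -
  have "f mod (2 * 2 ^ p) < 2 * 2 ^ p" by simp
  then have "Suc (f mod (2 * 2 ^ p)) < 2 ^ p + 2 ^ p \<longleftrightarrow> Suc (f mod (2 * 2 ^ p)) \<noteq> 2 * 2 ^ p"
    by linarith
  then show ?thesis using assms by (auto simp: counter_prog_def fun_eq_iff mod_Suc)
qed

text \<open>\<open>w\<close> is the phase of the third counter, which therefore tests bit
  \<open>e\<close> of \<open>f + w\<close>. The bound on \<open>w\<close> makes it its own residue
  at the start of the scan.\<close>

lemma halts_within_pass_prog:
  fixes R M :: "nat \<Rightarrow> nat"
  defines "T \<equiv> \<lambda>f. M (R rTb + f)" and "T' \<equiv> \<lambda>f. M (R rSp + f)"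
  assumes R: "R rOne = 1" "R rZero = 0" "R rTwo = 2" "R rThree = 3"
    and op: "R rOp \<le> 3"
    and S: "R rSiz = S" "S \<ge> 1" "R rSp = R rTb + S"
    and bits: "R rP = 2 ^ p" "R rQ = 2 ^ q" "R rE = 2 ^ e" "R rW = w" "w < 2 * 2 ^ e"
    and U: "U = pass_val (R rOp) (R rI) (R rJ) p q (\<lambda>f. bit (f + w) e) T T'"
    and Q: "\<And>R'. (\<And>x. x < 17 \<or> 26 < x \<Longrightarrow> R' x = R x) \<Longrightarrow> Q (R', overlay (R rTb) S U M)"
  shows "halts_within pass_prog (R, M) (50 * S) Q"
proof -
  define I where "I f s \<longleftrightarrow> (\<forall>x. x < 17 \<or> 26 < x \<longrightarrow> fst s x = R x) \<and> fst s rF = f \<and>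
      fst s cP = f mod (2 * 2 ^ p) \<and> fst s cQ = f mod (2 * 2 ^ q) \<and>
      fst s cE = (f + w) mod (2 * 2 ^ e) \<and> snd s = overlay (R rTb) f U M" for f and s :: ram_state
  have body: "halts_within (block [cell_prog, counter_prog cP rP, counter_prog cQ rQ,
      counter_prog cE rE, Add rF rF rOne]) s 40 (I (Suc f))" if f: "f < S" and s: "I f s" for f s
  proof (rule halts_within_loop_free)
    obtain R0 M0 where s_eq: "s = (R0, M0)" by (cases s)
    have R0: "R0 x = R x" if "x < 17 \<or> 26 < x" for x
      using s that by (auto simp: I_def s_eq)
    have M0: "M0 = overlay (R0 rTb) f U M" using s R0[of rTb] by (auto simp: I_def s_eq)
    have cs: "R0 rF = f" "R0 cP = f mod (2 * 2 ^ p)" "R0 cQ = f mod (2 * 2 ^ q)"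
      "R0 cE = (f + w) mod (2 * 2 ^ e)"
      using s by (auto simp: I_def s_eq)
    obtain R1 where R1: "run cell_prog (R0, M0) = (R1, overlay (R rTb) (Suc f) U M)"
      and R1_eq: "\<And>x. x \<notin> {rAd, rVa, rVb} \<Longrightarrow> R1 x = R0 x"
    proof (rule run_cell_prog[of R0 f S p q "\<lambda>f. bit (f + w) e" U M])
      show "R0 cP < R0 rP \<longleftrightarrow> \<not> bit f p" "R0 cQ < R0 rQ \<longleftrightarrow> \<not> bit f q"
        "R0 cE < R0 rE \<longleftrightarrow> \<not> bit (f + w) e"
        by (simp_all add: R0 cs bits bit_iff_counter)
      show "U = pass_val (R0 rOp) (R0 rI) (R0 rJ) p q (\<lambda>f. bit (f + w) e)
          (\<lambda>f. M (R0 rTb + f)) (\<lambda>f. M (R0 rSp + f))"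
        by (simp add: R0 U T_def T'_def)
    qed (use f R op S bits cs M0 in \<open>simp_all add: R0\<close>)
    show "I (Suc f) (run (block [cell_prog, counter_prog cP rP, counter_prog cQ rQ,
      counter_prog cE rE, Add rF rF rOne]) s)"
      using cs R bits unfolding s_eq
      by (simp add: R1 R1_eq R0 I_def
          run_counter_prog[where p = p and f = f] run_counter_prog[where p = q and f = f]
          run_counter_prog[where p = e and f = "f + w"])
  qed (simp_all add: cell_prog_def counter_prog_def)
  show ?thesis unfolding pass_prog_def
  proof (rule halts_within_Seq[where Q' = "I 0"])
    show "halts_within (block [Const rF 0, Const cP 0, Const cQ 0, Add cE rW rZero]) (R, M) 4 (I 0)"
      by (rule halts_within_loop_free) (use R bits in \<open>auto simp: I_def\<close>)
    show "halts_within (While_Less rF rSiz (block [cell_prog, counter_prog cP rP, counter_prog cQ rQ,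
         counter_prog cE rE, Add rF rF rOne])) s (41 * S + 1) Q" if "I 0 s" for s
    proof (rule halts_within_While[where I = I and T = 40 and N = S, OF that _ body])
      fix s assume s: "I S s"
      then have "s = (fst s, overlay (R rTb) S U M)" by (simp add: I_def prod_eq_iff)
      moreover have "Q (fst s, overlay (R rTb) S U M)" using s by (intro Q) (auto simp: I_def)
      ultimately show "Q s" by simp
    qed (use S in \<open>auto simp: I_def\<close>)
    show "4 + (41 * S + 1) \<le> 50 * S" using S(2) by simp
  qed
qed

section \<open>Layout of the table index\<close>

definition pos :: "nat \<Rightarrow> nat \<Rightarrow> nat \<Rightarrow> nat" where
  "pos r row col = row * r + col"

text \<open>Rows 0 to \<open>k - 1\<close> belong to the labels. A tournament row
  \<open>k - 1 + j\<close> is consulted only for positive \<open>j\<close>, so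
  \<open>k - 1 + r\<close> rows suffice. The row saved is the spare factor \<open>2 ^ r\<close> of
  the final estimate.\<close>

definition tsize :: "nat \<Rightarrow> nat \<Rightarrow> nat" where
  "tsize r k = 2 ^ (r * (k - 1 + r))"

text \<open>One bit directs each pair of distinct colours, so every index codes a tournament and no
  validity check is needed.\<close>

definition arc :: "nat \<Rightarrow> nat \<Rightarrow> nat \<Rightarrow> nat \<Rightarrow> nat \<Rightarrow> bool" where
  "arc r k f i j \<longleftrightarrow> i \<noteq> j \<and>
     (if i < j then bit f (pos r (k - 1 + j) i) else \<not> bit f (pos r (k - 1 + i) j))"

lemma tsize_ge_1: "tsize r k \<ge> 1"
  by (simp add: tsize_def)

lemma pos_less:
  assumes "row < n" "col < r"
  shows "pos r row col < r * n"
proof -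
  have "pos r row col < (row + 1) * r" using assms by (simp add: pos_def)
  also have "\<dots> \<le> n * r" using assms by (intro mult_le_mono1) simp
  finally show ?thesis by (simp add: mult.commute)
qed

lemma power_pos_le_tsize:
  assumes "row < k - 1 + r" "col < r"
  shows "2 ^ pos r row col \<le> tsize r k"
  unfolding tsize_def using pos_less[OF assms] by (intro power_increasing) auto

definition env :: "nat \<Rightarrow> nat \<Rightarrow> (nat \<Rightarrow> nat) \<Rightarrow> bool" where
  "env r k R \<longleftrightarrow> R rOne = 1 \<and> R rZero = 0 \<and> R rTwo = 2 \<and> R rThree = 3 \<and>
     R rCol = r \<and> R rLab = k - 1 \<and> R rSiz = tsize r k"

lemma envD:
  assumes "env r k R"
  shows "R rOne = 1" "R rZero = 0" "R rTwo = 2" "R rThree = 3"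
    "R rCol = r" "R rLab = k - 1" "R rSiz = tsize r k"
  using assms by (auto simp: env_def)

lemma halts_within_arc_prog:
  assumes env: "env r k R" and ij: "R rI = i" "R rJ = j" "i < r" "j < r" and p: "R rP = 2 ^ p"
    and Q: "\<And>R' e w. (\<And>x. x < 15 \<or> 26 < x \<Longrightarrow> R' x = R x) \<Longrightarrow> R' rE = 2 ^ e \<Longrightarrow> R' rW = w \<Longrightarrow>
      w < 2 * 2 ^ e \<Longrightarrow> (\<And>f. bit f p \<Longrightarrow> bit (f + w) e \<longleftrightarrow> \<not> arc r k f i j) \<Longrightarrow> Q (R', M)"
  shows "halts_within arc_prog (R, M) (6 * tsize r k + 4) Q"
proof -
  note R = envD[OF env]
  let ?S = "tsize r k"
  consider "i < j" | "j < i" | "i = j" by linarith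
  then show ?thesis
  proof cases
    case 1
    let ?e = "pos r (k - 1 + j) i"
    let ?R1 = "R(rRow := k - 1 + j)"
    let ?R2 = "?R1(rEx := ?e, rCt := ?e, rE := 2 ^ ?e)"
    have le: "6 * 2 ^ ?e \<le> 6 * ?S" using power_pos_le_tsize[of "k - 1 + j" k r i] ij by simp
    have pw: "halts_within (power_prog rE rRow rI) (?R1, M) (6 * 2 ^ ?e) (\<lambda>s. s = (?R2, M))"
      by (rule halts_within_power_prog) (use R ij in \<open>simp_all add: pos_def\<close>)
    have "halts_within (block [Add rRow rLab rJ, power_prog rE rRow rI, Add rW rE rZero]) (R, M)
        (1 + (6 * ?S + 1)) Q"
      unfolding block.simps
    proof (rule halts_within_Seq[OF _ _ order_refl])
      show "halts_within (Add rRow rLab rJ) (R, M) 1 (\<lambda>s. s = (?R1, M))"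
        by (rule halts_within_loop_free) (use R ij in auto)
      fix s assume s: "s = (?R1, M)"
      show "halts_within (Seq (power_prog rE rRow rI) (Add rW rE rZero)) s (6 * ?S + 1) Q"
        unfolding s
      proof (rule halts_within_Seq[OF pw])
        show "halts_within (Add rW rE rZero) s 1 Q" if "s = (?R2, M)" for s
        proof (rule halts_within_loop_free)
          show "Q (run (Add rW rE rZero) s)"
            unfolding that run.simps
            by (rule Q[where e = ?e and w = "2 ^ ?e"])
              (use R 1 in \<open>auto simp: bit_add_power arc_def\<close>)
        qed simp_all
      qed (use le in simp)
    qed
    then have "halts_within arc_prog (R, M) ((1 + (6 * ?S + 1)) + 1) Q"
      unfolding arc_prog_def by (rule halts_within_If) (use 1 ij in simp)
    then show ?thesis by (rule halts_within_mono) auto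
  next
    case 2
    let ?e = "pos r (k - 1 + i) j"
    let ?R1 = "R(rRow := k - 1 + i)"
    let ?R2 = "?R1(rEx := ?e, rCt := ?e, rE := 2 ^ ?e)"
    have le: "6 * 2 ^ ?e \<le> 6 * ?S" using power_pos_le_tsize[of "k - 1 + i" k r j] ij by simp
    have pw: "halts_within (power_prog rE rRow rJ) (?R1, M) (6 * 2 ^ ?e) (\<lambda>s. s = (?R2, M))"
      by (rule halts_within_power_prog) (use R ij in \<open>simp_all add: pos_def\<close>)
    have "halts_within (block [Add rRow rLab rI, power_prog rE rRow rJ, Const rW 0]) (R, M)
        (1 + (6 * ?S + 1)) Q"
      unfolding block.simps
    proof (rule halts_within_Seq[OF _ _ order_refl])
      show "halts_within (Add rRow rLab rI) (R, M) 1 (\<lambda>s. s = (?R1, M))"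
        by (rule halts_within_loop_free) (use R ij in auto)
      fix s assume s: "s = (?R1, M)"
      show "halts_within (Seq (power_prog rE rRow rJ) (Const rW 0)) s (6 * ?S + 1) Q"
        unfolding s
      proof (rule halts_within_Seq[OF pw])
        show "halts_within (Const rW 0) s 1 Q" if "s = (?R2, M)" for s
        proof (rule halts_within_loop_free)
          show "Q (run (Const rW 0) s)"
            unfolding that run.simps
            by (rule Q[where e = ?e and w = 0])
              (use R 2 in \<open>auto simp: bit_add_power arc_def\<close>)
        qed simp_all
      qed (use le in simp)
    qed
    then have "halts_within arc_prog (R, M) (((1 + (6 * ?S + 1)) + 1) + 1) Q"
      unfolding arc_prog_def using 2 ij
      by (intro halts_within_If) simp_all
    then show ?thesis by (rule halts_within_mono) auto
  next
    case 3
    have "halts_within (Seq (Add rE rP rZero) (Const rW 0)) (R, M) 2 Q"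
    proof (rule halts_within_loop_free)
      show "Q (run (Seq (Add rE rP rZero) (Const rW 0)) (R, M))"
        unfolding run.simps
        by (rule Q[where e = p and w = 0]) (use R 3 p in \<open>auto simp: arc_def\<close>)
    qed simp_all
    then have "halts_within arc_prog (R, M) ((2 + 1) + 1) Q"
      unfolding arc_prog_def using 3 ij by (intro halts_within_If) simp_all
    then show ?thesis by (rule halts_within_mono) auto
  qed
qed

section \<open>All passes of one operation\<close>

text \<open>The non-arc test is consulted only where bit \<open>p\<close> is set; this is why
  \<open>arc_prog\<close> may put bit \<open>p\<close> itself in its place when
  \<open>i = j\<close>.\<close>

lemma pass_val_cong:
  assumes "\<And>f. bit f p \<Longrightarrow> h f \<longleftrightarrow> h' f"
  shows "pass_val op i j p q h T T' = pass_val op i j p q h' T T'"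
  using assms by (auto simp: pass_val_def fun_eq_iff)

text \<open>A pass as a map on functions over all of \<open>nat\<close>. Being the identity outside
  the table, it can be related to the memory by an equation between functions.\<close>

definition entry :: "nat \<Rightarrow> nat \<Rightarrow> nat \<Rightarrow> nat \<Rightarrow> nat \<Rightarrow> nat \<Rightarrow> nat \<Rightarrow> (nat \<Rightarrow> nat) \<Rightarrow> (nat \<Rightarrow> nat) \<Rightarrow>
    nat \<Rightarrow> nat" where
  "entry r k op a b i j T T' f =
     (if f < tsize r k
      then pass_val op i j (pos r a i) (pos r b j) (\<lambda>f. \<not> arc r k f i j) T T' f else T f)"

lemma halts_within_step_prog:
  assumes env: "env r k R"
    and ij: "R rI = i" "R rJ = j" "i < r" "j < r"
    and ab: "R rA = a" "R rB = b" "a < k" "b < k"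
    and op: "R rOp \<le> 3"
    and tb: "R rSp = R rTb + tsize r k"
    and Q: "\<And>R' M'. (\<And>x. x < 12 \<or> 26 < x \<Longrightarrow> R' x = R x) \<Longrightarrow> R' rJ = Suc j \<Longrightarrow>
      (\<And>x. x < R rTb \<or> R rSp \<le> x \<Longrightarrow> M' x = M x) \<Longrightarrow>
      (\<lambda>f. M' (R rTb + f)) =
        entry r k (R rOp) a b i j (\<lambda>f. M (R rTb + f)) (\<lambda>f. M (R rSp + f)) \<Longrightarrow> Q (R', M')"
  shows "halts_within step_prog (R, M) (75 * tsize r k) Q"
proof -
  note R = envD[OF env]
  let ?S = "tsize r k"
  let ?p = "pos r a i" let ?q = "pos r b j"
  let ?R1 = "R(rEx := ?p, rCt := ?p, rP := 2 ^ ?p)"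
  let ?R2 = "?R1(rEx := ?q, rCt := ?q, rQ := 2 ^ ?q)"
  have le: "6 * 2 ^ ?p \<le> 6 * ?S" "6 * 2 ^ ?q \<le> 6 * ?S"
    using power_pos_le_tsize[of a k r i] power_pos_le_tsize[of b k r j] ij ab by auto
  have S1: "?S \<ge> 1" by (rule tsize_ge_1)
  have 1: "halts_within (power_prog rP rA rI) (R, M) (6 * ?S) (\<lambda>s. s = (?R1, M))"
    by (rule halts_within_mono[OF halts_within_power_prog[where Q = "\<lambda>s. s = (?R1, M)"] le(1)])
      (use R ij ab in \<open>simp_all add: pos_def\<close>)
  have 2: "halts_within (power_prog rQ rB rJ) (?R1, M) (6 * ?S) (\<lambda>s. s = (?R2, M))"
    by (rule halts_within_mono[OF halts_within_power_prog[where Q = "\<lambda>s. s = (?R2, M)"] le(2)])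
      (use R ij ab in \<open>simp_all add: pos_def\<close>)
  have env2: "env r k ?R2" using env by (auto simp: env_def)
  have 3: "halts_within (Seq arc_prog (Seq pass_prog (Add rJ rJ rOne))) (?R2, M)
      ((6 * ?S + 4) + (50 * ?S + 1)) Q"
  proof (rule halts_within_Seq[where Q' = "\<lambda>s. halts_within (Seq pass_prog (Add rJ rJ rOne)) s
        (50 * ?S + 1) Q", OF _ _ order_refl])
    show "halts_within arc_prog (?R2, M) (6 * ?S + 4)
        (\<lambda>s. halts_within (Seq pass_prog (Add rJ rJ rOne)) s (50 * ?S + 1) Q)"
    proof (rule halts_within_arc_prog[OF env2])
      fix R3 e w
      assume R3: "\<And>x. x < 15 \<or> 26 < x \<Longrightarrow> R3 x = ?R2 x" and e: "R3 rE = 2 ^ e" and w: "R3 rW = w"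
        "w < 2 * 2 ^ e" and h: "\<And>f. bit f ?p \<Longrightarrow> bit (f + w) e \<longleftrightarrow> \<not> arc r k f i j"
      let ?T = "\<lambda>f. M (R rTb + f)" and ?T' = "\<lambda>f. M (R rSp + f)"
      let ?U = "pass_val (R rOp) i j ?p ?q (\<lambda>f. \<not> arc r k f i j) ?T ?T'"
      have U: "?U = pass_val (R3 rOp) (R3 rI) (R3 rJ) ?p ?q (\<lambda>f. bit (f + w) e)
          (\<lambda>f. M (R3 rTb + f)) (\<lambda>f. M (R3 rSp + f))"
        using R3[of rOp] R3[of rI] R3[of rJ] R3[of rTb] R3[of rSp] ij
        by (simp add: pass_val_cong[OF h])
      have "halts_within pass_prog (R3, M) (50 * ?S)
          (\<lambda>s. halts_within (Add rJ rJ rOne) s 1 Q)"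
      proof (rule halts_within_pass_prog[OF _ _ _ _ _ _ _ _ _ _ e w U])
        fix R4 assume R4: "\<And>x. x < 17 \<or> 26 < x \<Longrightarrow> R4 x = R3 x"
        show "halts_within (Add rJ rJ rOne) (R4, overlay (R3 rTb) ?S ?U M) 1 Q"
        proof (rule halts_within_loop_free)
          show "Q (run (Add rJ rJ rOne) (R4, overlay (R3 rTb) ?S ?U M))"
            unfolding run.simps
            by (rule Q) (use R R3 R4 ij tb in \<open>auto simp: overlay_def entry_def\<close>)
        qed simp_all
      qed (use R R3 S1 op tb in simp_all)
      then show "halts_within (Seq pass_prog (Add rJ rJ rOne)) (R3, M) (50 * ?S + 1) Q"
        by (rule halts_within_Seq) auto
    qed (use ij in simp_all)
  qed
  have "halts_within step_prog (R, M) (6 * ?S + (6 * ?S + ((6 * ?S + 4) + (50 * ?S + 1)))) Q"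
    unfolding step_prog_def block.simps
    apply (rule halts_within_Seq[OF 1 _ order_refl])
    apply (erule ssubst)
    apply (rule halts_within_Seq[OF 2 _ order_refl])
    apply (erule ssubst)
    apply (rule 3)
    done
  then show ?thesis by (rule halts_within_mono) (use S1 in auto)
qed

text \<open>\<open>Inv\<close> stays abstract: each operation supplies the meaning of the table
  after the passes that precede \<open>(i, j)\<close> lexicographically. The double loop is thus
  verified once for all four operations.\<close>

lemma halts_within_nest_prog:
  fixes R M :: "nat \<Rightarrow> nat"
  defines "T' \<equiv> \<lambda>f. M (R rSp + f)"
  assumes env: "env r k R" and r: "r \<ge> 1"
    and ab: "R rA = a" "R rB = b" "a < k" "b < k"
    and op: "R rOp = op" "op \<le> 3"
    and tb: "R rSp = R rTb + tsize r k"
    and Inv_0: "Inv 0 0 (\<lambda>f. M (R rTb + f))"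
    and Inv_step: "\<And>i j T. i < r \<Longrightarrow> j < r \<Longrightarrow> Inv i j T \<Longrightarrow> Inv i (Suc j) (entry r k op a b i j T T')"
    and Inv_next: "\<And>i T. i < r \<Longrightarrow> Inv i r T \<Longrightarrow> Inv (Suc i) 0 T"
    and Q: "\<And>R' M'. (\<And>x. x < 11 \<or> 26 < x \<Longrightarrow> R' x = R x) \<Longrightarrow>
      (\<And>x. x < R rTb \<or> R rSp \<le> x \<Longrightarrow> M' x = M x) \<Longrightarrow> Inv r 0 (\<lambda>f. M' (R rTb + f)) \<Longrightarrow> Q (R', M')"
  shows "halts_within nest_prog (R, M) (90 * (r\<^sup>2 * tsize r k)) Q"
proof -
  note R = envD[OF env]
  let ?S = "tsize r k"
  have S1: "?S \<ge> 1" by (rule tsize_ge_1)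
  define J where "J i j s \<longleftrightarrow> (\<forall>x. x < 11 \<or> 26 < x \<longrightarrow> fst s x = R x) \<and>
      fst s rI = i \<and> fst s rJ = j \<and> (\<forall>x. x < R rTb \<or> R rSp \<le> x \<longrightarrow> snd s x = M x) \<and>
      Inv i j (\<lambda>f. snd s (R rTb + f))" for i j and s :: ram_state
  define I where "I i s \<longleftrightarrow> (\<forall>x. x < 11 \<or> 26 < x \<longrightarrow> fst s x = R x) \<and>
      fst s rI = i \<and> (\<forall>x. x < R rTb \<or> R rSp \<le> x \<longrightarrow> snd s x = M x) \<and>
      Inv i 0 (\<lambda>f. snd s (R rTb + f))" for i and s :: ram_state
  have step: "halts_within step_prog s (75 * ?S) (J i (Suc j))"
    if ij: "i < r" "j < r" and s: "J i j s" for i j s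
  proof -
    obtain R0 M0 where s_eq: "s = (R0, M0)" by (cases s)
    have R0: "R0 x = R x" if "x < 11 \<or> 26 < x" for x
      using s that by (auto simp: J_def s_eq)
    have M0: "M0 x = M x" if "x < R rTb \<or> R rSp \<le> x" for x
      using s that by (auto simp: J_def s_eq)
    \<comment> \<open>Passes write only below \<open>rSp\<close>, so the second operand is constant
      throughout.\<close>
    have T': "(\<lambda>f. M0 (R rSp + f)) = T'" by (simp add: M0 T'_def)
    have inv: "Inv i j (\<lambda>f. M0 (R rTb + f))" "R0 rI = i" "R0 rJ = j"
      using s by (auto simp: J_def s_eq)
    have env0: "env r k R0" using env by (auto simp: env_def R0)
    show ?thesis unfolding s_eq
    proof (rule halts_within_step_prog[OF env0 inv(2,3) ij, where a = a and b = b])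
      fix R1 M1
      assume R1: "\<And>x. x < 12 \<or> 26 < x \<Longrightarrow> R1 x = R0 x" "R1 rJ = Suc j"
        and M1: "\<And>x. x < R0 rTb \<or> R0 rSp \<le> x \<Longrightarrow> M1 x = M0 x"
        "(\<lambda>f. M1 (R0 rTb + f)) =
          entry r k (R0 rOp) a b i j (\<lambda>f. M0 (R0 rTb + f)) (\<lambda>f. M0 (R0 rSp + f))"
      have "(\<lambda>f. M1 (R rTb + f)) = entry r k op a b i j (\<lambda>f. M0 (R rTb + f)) T'"
        using M1(2) by (simp add: R0 op T')
      then have "Inv i (Suc j) (\<lambda>f. M1 (R rTb + f))" using Inv_step[OF ij inv(1)] by simp
      moreover have "M1 x = M x" if "x < R rTb \<or> R rSp \<le> x" for x
        using M1(1)[of x] M0[OF that] that by (simp add: R0)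
      ultimately show "J i (Suc j) (R1, M1)" using R1 inv(2) by (auto simp: J_def R0)
    qed (use ab op tb in \<open>simp_all add: R0\<close>)
  qed
  have row: "halts_within (block [Const rJ 0, While_Less rJ rCol step_prog, Add rI rI rOne]) s
      (1 + ((r * (75 * ?S + 1) + 1) + 1)) (I (Suc i))" if i: "i < r" and s: "I i s" for i s
    unfolding block.simps
  proof (rule halts_within_Seq[OF _ _ order_refl])
    show "halts_within (Const rJ 0) s 1 (J i 0)"
      by (rule halts_within_loop_free) (use s in \<open>cases s; auto simp: I_def J_def\<close>)+
    show "halts_within (Seq (While_Less rJ rCol step_prog) (Add rI rI rOne)) s
        ((r * (75 * ?S + 1) + 1) + 1) (I (Suc i))" if "J i 0 s" for s
    proof (rule halts_within_Seq[OF _ _ order_refl])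
      show "halts_within (While_Less rJ rCol step_prog) s (r * (75 * ?S + 1) + 1) (J i r)"
        by (rule halts_within_While[where I = "J i" and N = r, OF that _ step[OF i]])
          (use R in \<open>auto simp: J_def\<close>)
      show "halts_within (Add rI rI rOne) s 1 (I (Suc i))" if "J i r s" for s
        by (rule halts_within_loop_free)
          (use that Inv_next[OF i] R in \<open>cases s; auto simp: I_def J_def\<close>)+
    qed
  qed
  have all: "halts_within nest_prog (R, M) (1 + (r * (1 + ((r * (75 * ?S + 1) + 1) + 1) + 1) + 1)) Q"
    unfolding nest_prog_def
  proof (rule halts_within_Seq[OF _ _ order_refl])
    show "halts_within (Const rI 0) (R, M) 1 (I 0)"
      by (rule halts_within_loop_free) (use Inv_0 in \<open>auto simp: I_def\<close>)
    show "halts_within (While_Less rI rCol (block [Const rJ 0, While_Less rJ rCol step_prog,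
         Add rI rI rOne])) s (r * (1 + ((r * (75 * ?S + 1) + 1) + 1) + 1) + 1) Q" if "I 0 s" for s
    proof (rule halts_within_While[where I = I and N = r, OF that _ row])
      fix s assume "I r s"
      then show "Q s" by (cases s) (auto simp: I_def intro!: Q)
    qed (use R in \<open>auto simp: I_def\<close>)
  qed
  have "r \<le> r * r" "1 \<le> r * r" using r by (simp_all add: Suc_leI)
  moreover have "r * r \<le> r * r * ?S" using S1 by simp
  moreover have "1 + (r * (1 + ((r * (75 * ?S + 1) + 1) + 1) + 1) + 1) =
      75 * (r * r * ?S) + r * r + 4 * r + 2" by (simp add: algebra_simps)
  ultimately have "1 + (r * (1 + ((r * (75 * ?S + 1) + 1) + 1) + 1) + 1) \<le> 90 * (r\<^sup>2 * ?S)"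
    unfolding power2_eq_square by linarith
  then show ?thesis using all by (auto intro: halts_within_mono)
qed

section \<open>The tables\<close>

lemma pos_eq_iff:
  assumes "col < r" "col' < r"
  shows "pos r row col = pos r row' col' \<longleftrightarrow> row = row' \<and> col = col'"
proof
  assume eq: "pos r row col = pos r row' col'"
  have "(row * r + col) div r = row" "(row' * r + col') div r = row'"
    "(row * r + col) mod r = col" "(row' * r + col') mod r = col'"
    using assms by auto
  then show "row = row' \<and> col = col'" using eq unfolding pos_def by metis
qed simp

text \<open>The larger of two distinct colours is at least 1, so only rows from \<open>k\<close> on
  matter; editing label rows leaves the tournament alone.\<close>

lemma arc_cong:
  assumes "i < r" "j < r" "k \<ge> 1"
    and "\<And>row col. row \<ge> k \<Longrightarrow> col < r \<Longrightarrow> bit f (pos r row col) \<longleftrightarrow> bit f' (pos r row col)"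
  shows "arc r k f i j \<longleftrightarrow> arc r k f' i j"
  using assms by (auto simp: arc_def)

lemma arc_irrefl: "arc r k f i j \<Longrightarrow> i \<noteq> j"
  by (simp add: arc_def)

lemma arc_asym: "arc r k f i j \<Longrightarrow> \<not> arc r k f j i"
  by (auto simp: arc_def split: if_splits)

lemma less_power_iff_bit: "(f::nat) < 2 ^ n \<longleftrightarrow> (\<forall>m\<ge>n. \<not> bit f m)"
proof
  assume "f < 2 ^ n"
  then have "take_bit n f = f" by (simp add: take_bit_nat_eq_self_iff)
  then show "\<forall>m\<ge>n. \<not> bit f m" by (metis bit_take_bit_iff leD)
next
  assume "\<forall>m\<ge>n. \<not> bit f m"
  then have "take_bit n f = f" by (intro bit_eqI) (auto simp: bit_take_bit_iff not_less[symmetric])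
  then show "f < 2 ^ n" by (simp add: take_bit_nat_eq_self_iff)
qed

lemma plus_power_less_tsize:
  assumes "f < tsize r k" "\<not> bit f (pos r row col)" "row < k - 1 + r" "col < r"
  shows "f + 2 ^ pos r row col < tsize r k"
  using assms pos_less[OF assms(3,4)] unfolding tsize_def less_power_iff_bit
  by (auto simp: bit_plus_power)

lemma dcw_graph_wf:
  assumes "dcw_expression k X"
  shows "finite (pverts (dcw_graph X))" "pverts (dcw_graph X) \<noteq> {}" "k \<ge> 1"
    "parcs (dcw_graph X) \<subseteq> pverts (dcw_graph X) \<times> pverts (dcw_graph X)"
    "v \<in> pverts (dcw_graph X) \<Longrightarrow> dcw_label X v \<in> {1..k}"
  using assms by (induction X) auto

section \<open>Meaning of the table entries\<close>

text \<open>A homomorphism into the tournament coded by \<open>f\<close> that uses only pairs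
  (label, colour) allowed by \<open>f\<close>. Colours start at 0 here, and labels are shifted by 1
  to become row numbers.\<close>

definition fits :: "nat \<Rightarrow> nat \<Rightarrow> dcw \<Rightarrow> nat \<Rightarrow> (nat \<Rightarrow> nat) \<Rightarrow> bool" where
  "fits r k X f c \<longleftrightarrow>
     (\<forall>v \<in> pverts (dcw_graph X). c v < r \<and> bit f (pos r (dcw_label X v - 1) (c v))) \<and>
     (\<forall>(u, v) \<in> parcs (dcw_graph X). arc r k f (c u) (c v))"

definition represents :: "nat \<Rightarrow> nat \<Rightarrow> dcw \<Rightarrow> (nat \<Rightarrow> nat) \<Rightarrow> bool" where
  "represents r k X T \<longleftrightarrow> (\<forall>f < tsize r k. T f > 0 \<longleftrightarrow> (\<exists>c. fits r k X f c))"

section \<open>Vertex creation\<close>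

text \<open>A fresh table may contain leftovers, so nothing is claimed before the first pass, which
  overwrites them. Once \<open>i\<close> is positive, every colour has been seen and further passes
  change no truth value.\<close>

definition create_inv :: "nat \<Rightarrow> nat \<Rightarrow> nat \<Rightarrow> nat \<Rightarrow> nat \<Rightarrow> (nat \<Rightarrow> nat) \<Rightarrow> bool" where
  "create_inv r k b i j T \<longleftrightarrow> i = 0 \<and> j = 0 \<or>
     (\<forall>f < tsize r k. T f > 0 \<longleftrightarrow> (\<exists>y<r. (0 < i \<or> y < j) \<and> bit f (pos r b y)))"

lemma create_inv_step:
  assumes "j < r" "create_inv r k b i j T"
  shows "create_inv r k b i (Suc j) (entry r k 0 a b i j T T')"
  using assms by (auto simp: create_inv_def entry_def pass_val_def less_Suc_eq)

lemma create_inv_next: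
  assumes "1 \<le> r" "create_inv r k b i r T"
  shows "create_inv r k b (Suc i) 0 T"
  using assms by (auto simp: create_inv_def)

lemma create_inv_final:
  assumes "1 \<le> r" "create_inv r k (a - 1) r 0 T"
  shows "represents r k (Create v a) T"
proof -
  have "(\<exists>c. fits r k (Create v a) f c) \<longleftrightarrow> (\<exists>y<r. bit f (pos r (a - 1) y))" for f
  proof
    assume "\<exists>y<r. bit f (pos r (a - 1) y)"
    then obtain y where "y < r" "bit f (pos r (a - 1) y)" by blast
    then have "fits r k (Create v a) f (\<lambda>_. y)" by (simp add: fits_def)
    then show "\<exists>c. fits r k (Create v a) f c" by blast
  qed (auto simp: fits_def)
  then show ?thesis using assms by (auto simp: represents_def create_inv_def)
qed

section \<open>Disjoint union\<close>

definition disj_inv :: "nat \<Rightarrow> nat \<Rightarrow> (nat \<Rightarrow> nat) \<Rightarrow> (nat \<Rightarrow> nat) \<Rightarrow> nat \<Rightarrow> nat \<Rightarrow> (nat \<Rightarrow> nat) \<Rightarrow> bool"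
  where "disj_inv r k T0 T' i j T \<longleftrightarrow>
     (\<forall>f < tsize r k. T f > 0 \<longleftrightarrow> T0 f > 0 \<and> (0 < i \<or> 0 < j \<longrightarrow> T' f > 0))"

lemma disj_inv_step:
  assumes "disj_inv r k T0 T' i j T"
  shows "disj_inv r k T0 T' i (Suc j) (entry r k 1 a b i j T T')"
  using assms by (auto simp: disj_inv_def entry_def pass_val_def)

lemma disj_inv_next:
  assumes "1 \<le> r" "disj_inv r k T0 T' i r T"
  shows "disj_inv r k T0 T' (Suc i) 0 T"
  using assms by (auto simp: disj_inv_def)

text \<open>Since \<open>f\<close> bounds the used pairs only from above, both sides are tested
  against the same \<open>f\<close>. Two colourings on disjoint vertex sets with no arcs between
  them can be glued.\<close>

lemma fits_Disj:
  assumes "dcw_expression k (Disj X Y)"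
  shows "(\<exists>c. fits r k (Disj X Y) f c) \<longleftrightarrow> (\<exists>c. fits r k X f c) \<and> (\<exists>c. fits r k Y f c)"
proof
  let ?V = "pverts (dcw_graph X)" and ?W = "pverts (dcw_graph Y)"
  have disj: "?V \<inter> ?W = {}" using assms by simp
  have X: "parcs (dcw_graph X) \<subseteq> ?V \<times> ?V" and Y: "parcs (dcw_graph Y) \<subseteq> ?W \<times> ?W"
    using assms dcw_graph_wf(4)[of k X] dcw_graph_wf(4)[of k Y] by auto
  {
    assume "\<exists>c. fits r k (Disj X Y) f c"
    then obtain c where c: "fits r k (Disj X Y) f c" ..
    have "c v < r \<and> bit f (pos r (dcw_label X v - 1) (c v))" if "v \<in> ?V" for v
    proof -
      have "v \<in> pverts (dcw_graph (Disj X Y))" "dcw_label (Disj X Y) v = dcw_label X v"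
        using that by auto
      then show ?thesis using c unfolding fits_def by metis
    qed
    then have "fits r k X f c" using c by (auto simp: fits_def)
    moreover have "c v < r \<and> bit f (pos r (dcw_label Y v - 1) (c v))" if "v \<in> ?W" for v
    proof -
      have "v \<in> pverts (dcw_graph (Disj X Y))" "dcw_label (Disj X Y) v = dcw_label Y v"
        using that disj by auto
      then show ?thesis using c unfolding fits_def by metis
    qed
    then have "fits r k Y f c" using c by (auto simp: fits_def)
    ultimately show "(\<exists>c. fits r k X f c) \<and> (\<exists>c. fits r k Y f c)" by blast
  next
    assume "(\<exists>c. fits r k X f c) \<and> (\<exists>c. fits r k Y f c)"
    then obtain c c' where c: "fits r k X f c" "fits r k Y f c'" by blast
    have "fits r k (Disj X Y) f (\<lambda>v. if v \<in> ?V then c v else c' v)"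
      using c X Y disj unfolding fits_def dcw_graph.simps dcw_label.simps pair_pre_digraph.simps
      by (auto split: if_splits) (blast | fastforce)+
    then show "\<exists>c. fits r k (Disj X Y) f c" by blast
  }
qed

section \<open>Arc insertion\<close>

definition used :: "dcw \<Rightarrow> (nat \<Rightarrow> nat) \<Rightarrow> nat \<Rightarrow> nat \<Rightarrow> bool" where
  "used X c l x \<longleftrightarrow> (\<exists>v \<in> pverts (dcw_graph X). dcw_label X v = l \<and> c v = x)"

text \<open>Interpolates between \<open>X\<close> and the graph with all new arcs: only the colour
  pairs in \<open>D\<close> have been dealt with so far.\<close>

definition insert_fits :: "nat \<Rightarrow> nat \<Rightarrow> dcw \<Rightarrow> nat \<Rightarrow> nat \<Rightarrow> (nat \<times> nat) set \<Rightarrow> nat \<Rightarrow> (nat \<Rightarrow> nat) \<Rightarrow> bool"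
  where "insert_fits r k X a b D f c \<longleftrightarrow> fits r k X f c \<and>
    (\<forall>(x, y) \<in> D. used X c a x \<and> used X c b y \<longrightarrow> arc r k f x y)"

definition pairs_before :: "nat \<Rightarrow> nat \<Rightarrow> nat \<Rightarrow> (nat \<times> nat) set" where
  "pairs_before r i j = {(x, y). x < r \<and> y < r \<and> (x < i \<or> x = i \<and> y < j)}"

definition insert_inv :: "nat \<Rightarrow> nat \<Rightarrow> dcw \<Rightarrow> nat \<Rightarrow> nat \<Rightarrow> nat \<Rightarrow> nat \<Rightarrow> (nat \<Rightarrow> nat) \<Rightarrow> bool" where
  "insert_inv r k X a b i j T \<longleftrightarrow>
     (\<forall>f < tsize r k. T f > 0 \<longleftrightarrow> (\<exists>c. insert_fits r k X a b (pairs_before r i j) f c))"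

lemma arc_diff_power:
  assumes "k \<ge> 1" "l \<in> {1..k}" "x < r" "bit f (pos r (l - 1) x)" "i < r" "j < r"
  shows "arc r k (f - 2 ^ pos r (l - 1) x) i j \<longleftrightarrow> arc r k f i j"
  using assms by (intro arc_cong) (auto simp: bit_diff_power pos_eq_iff)

text \<open>The cleared bit lies in a label row, so the tournament is unchanged and only a vertex
  with label \<open>l\<close> and colour \<open>x\<close> notices the difference.\<close>

lemma fits_diff_power:
  assumes X: "dcw_expression k X" and l: "l \<in> {1..k}" "x < r" and bit: "bit f (pos r (l - 1) x)"
  shows "fits r k X (f - 2 ^ pos r (l - 1) x) c \<longleftrightarrow> fits r k X f c \<and> \<not> used X c l x"
proof -
  let ?V = "pverts (dcw_graph X)"
  let ?f = "f - 2 ^ pos r (l - 1) x"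
  have wf: "k \<ge> 1" "parcs (dcw_graph X) \<subseteq> ?V \<times> ?V" using dcw_graph_wf[OF X] by blast+
  have lab: "dcw_label X v \<in> {1..k}" if "v \<in> ?V" for v using dcw_graph_wf(5)[OF X that] .
  have arcs: "arc r k ?f i j \<longleftrightarrow> arc r k f i j" if "i < r" "j < r" for i j
    using arc_diff_power[OF wf(1) l bit that] .
  have 1: "bit ?f (pos r (dcw_label X v - 1) (c v)) \<longleftrightarrow>
      bit f (pos r (dcw_label X v - 1) (c v)) \<and> \<not> (dcw_label X v = l \<and> c v = x)"
    if "v \<in> ?V" "c v < r" for v
    using lab[OF that(1)] l that(2) bit by (auto simp: bit_diff_power pos_eq_iff)
  have 2: "(\<forall>v\<in>?V. c v < r \<and> bit ?f (pos r (dcw_label X v - 1) (c v))) \<longleftrightarrow>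
      (\<forall>v\<in>?V. c v < r \<and> bit f (pos r (dcw_label X v - 1) (c v))) \<and> \<not> used X c l x"
    using 1 unfolding used_def by blast
  have 3: "(\<forall>(u, v) \<in> parcs (dcw_graph X). arc r k ?f (c u) (c v)) \<longleftrightarrow>
      (\<forall>(u, v) \<in> parcs (dcw_graph X). arc r k f (c u) (c v))" if "\<forall>v\<in>?V. c v < r"
  proof (rule ball_cong[OF refl])
    fix e assume "e \<in> parcs (dcw_graph X)"
    then obtain u v where "e = (u, v)" "u \<in> ?V" "v \<in> ?V" using wf(2) by auto
    then show "(case e of (u, v) \<Rightarrow> arc r k ?f (c u) (c v)) =
        (case e of (u, v) \<Rightarrow> arc r k f (c u) (c v))" using arcs that by simp
  qed
  show ?thesis unfolding fits_def 2 using 3 by blast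
qed

lemma insert_fits_diff_power:
  assumes X: "dcw_expression k X" and l: "l \<in> {1..k}" "x < r" and bit: "bit f (pos r (l - 1) x)"
    and D: "D \<subseteq> {..<r} \<times> {..<r}"
  shows "insert_fits r k X a b D (f - 2 ^ pos r (l - 1) x) c \<longleftrightarrow>
    insert_fits r k X a b D f c \<and> \<not> used X c l x"
proof -
  have "(\<forall>(i, j) \<in> D. used X c a i \<and> used X c b j \<longrightarrow> arc r k (f - 2 ^ pos r (l - 1) x) i j) \<longleftrightarrow>
      (\<forall>(i, j) \<in> D. used X c a i \<and> used X c b j \<longrightarrow> arc r k f i j)"
  proof (rule ball_cong[OF refl])
    fix e assume "e \<in> D"
    then obtain i j where "e = (i, j)" "i < r" "j < r" using D by auto
    then show "(case e of (i, j) \<Rightarrow> used X c a i \<and> used X c b j \<longrightarrow>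
          arc r k (f - 2 ^ pos r (l - 1) x) i j) =
        (case e of (i, j) \<Rightarrow> used X c a i \<and> used X c b j \<longrightarrow> arc r k f i j)"
      using arc_diff_power[OF dcw_graph_wf(3)[OF X] l bit] by simp
  qed
  then show ?thesis unfolding insert_fits_def fits_diff_power[OF X l bit] by blast
qed

lemma insert_inv_step:
  assumes X: "dcw_expression k X" and ab: "a \<in> {1..k}" "b \<in> {1..k}" and ij: "i < r" "j < r"
    and inv: "insert_inv r k X a b i j T"
  shows "insert_inv r k X a b i (Suc j) (entry r k 2 (a - 1) (b - 1) i j T T')"
  unfolding insert_inv_def
proof (intro allI impI)
  fix f assume f: "f < tsize r k"
  let ?p = "pos r (a - 1) i" and ?q = "pos r (b - 1) j"
  let ?D = "pairs_before r i j"
  have D: "pairs_before r i (Suc j) = insert (i, j) ?D" "?D \<subseteq> {..<r} \<times> {..<r}"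
    using ij by (auto simp: pairs_before_def)
  have new: "insert_fits r k X a b (pairs_before r i (Suc j)) f c \<longleftrightarrow>
      insert_fits r k X a b ?D f c \<and> (used X c a i \<and> used X c b j \<longrightarrow> arc r k f i j)" for c
    unfolding D(1) by (auto simp: insert_fits_def)
  have T: "T f > 0 \<longleftrightarrow> (\<exists>c. insert_fits r k X a b ?D f c)" if "f < tsize r k" for f
    using inv that by (auto simp: insert_inv_def)
  show "entry r k 2 (a - 1) (b - 1) i j T T' f > 0 \<longleftrightarrow>
      (\<exists>c. insert_fits r k X a b (pairs_before r i (Suc j)) f c)"
  proof (cases "bit f ?p \<and> bit f ?q \<and> \<not> arc r k f i j")
    case True
    then have "entry r k 2 (a - 1) (b - 1) i j T T' f > 0 \<longleftrightarrow> T (f - 2 ^ ?p) > 0 \<or> T (f - 2 ^ ?q) > 0"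
      using f by (auto simp: entry_def pass_val_def)
    also have "\<dots> \<longleftrightarrow> (\<exists>c. insert_fits r k X a b ?D (f - 2 ^ ?p) c) \<or>
        (\<exists>c. insert_fits r k X a b ?D (f - 2 ^ ?q) c)"
      using f by (simp add: T)
    \<comment> \<open>Not using both pairs means omitting one of them, and the existence of a
      colouring distributes over this disjunction.\<close>
    also have "\<dots> \<longleftrightarrow> (\<exists>c. insert_fits r k X a b ?D f c \<and> \<not> (used X c a i \<and> used X c b j))"
      using True insert_fits_diff_power[OF X ab(1) ij(1) _ D(2)]
        insert_fits_diff_power[OF X ab(2) ij(2) _ D(2)] by blast
    finally show ?thesis using new True by blast
  next
    case False
    \<comment> \<open>A pair whose bit is clear cannot be used, so either the new condition is
      vacuous or \<open>(i, j)\<close> is an arc and it holds.\<close>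
    have "bit f (pos r (l - 1) x)" if "fits r k X f c" "used X c l x" for c l x
      using that by (auto simp: fits_def used_def)
    then have "insert_fits r k X a b (pairs_before r i (Suc j)) f c \<longleftrightarrow>
        insert_fits r k X a b ?D f c" for c
      using False new unfolding insert_fits_def by blast
    moreover have "entry r k 2 (a - 1) (b - 1) i j T T' f = T f"
      using False by (auto simp: entry_def pass_val_def)
    ultimately show ?thesis using T[OF f] by simp
  qed
qed

lemma insert_inv_next:
  assumes "insert_inv r k X a b i r T"
  shows "insert_inv r k X a b (Suc i) 0 T"
proof -
  have "pairs_before r (Suc i) 0 = pairs_before r i r" by (auto simp: pairs_before_def)
  then show ?thesis using assms by (simp add: insert_inv_def)
qed

lemma insert_inv_init:
  assumes "represents r k X T"
  shows "insert_inv r k X a b 0 0 T"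
  using assms by (simp add: insert_inv_def represents_def insert_fits_def pairs_before_def)

text \<open>An inserted arc joins colour \<open>x\<close> to colour \<open>y\<close> exactly when
  \<open>(a, x)\<close> and \<open>(b, y)\<close> are both used, so ranging over all colour pairs
  accounts for every inserted arc.\<close>

lemma insert_inv_final:
  assumes "insert_inv r k X a b r 0 T"
  shows "represents r k (Insert_Arcs a b X) T"
proof -
  have D: "pairs_before r r 0 = {..<r} \<times> {..<r}" by (auto simp: pairs_before_def)
  have "insert_fits r k X a b (pairs_before r r 0) f c \<longleftrightarrow> fits r k (Insert_Arcs a b X) f c" for f c
    unfolding D by (auto simp: insert_fits_def fits_def used_def) (metis lessThan_iff)
  then show ?thesis using assms by (simp add: insert_inv_def represents_def)
qed

section \<open>Relabelling\<close>

text \<open>Interpolates between \<open>X\<close> and the relabelled graph: vertices of label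
  \<open>a\<close> whose colour lies in \<open>D\<close> are already judged by row
  \<open>b\<close>.\<close>

definition relabel_fits :: "nat \<Rightarrow> nat \<Rightarrow> dcw \<Rightarrow> nat \<Rightarrow> nat \<Rightarrow> nat set \<Rightarrow> nat \<Rightarrow> (nat \<Rightarrow> nat) \<Rightarrow> bool" where
  "relabel_fits r k X a b D f c \<longleftrightarrow>
     (\<forall>v \<in> pverts (dcw_graph X). c v < r \<and>
        bit f (pos r ((if dcw_label X v = a \<and> c v \<in> D then b else dcw_label X v) - 1) (c v))) \<and>
     (\<forall>(u, v) \<in> parcs (dcw_graph X). arc r k f (c u) (c v))"

text \<open>Colour \<open>i\<close> is treated only by the diagonal pass \<open>(i, i)\<close>,
  hence counts as done from \<open>j = i + 1\<close> on.\<close>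

definition colors_before :: "nat \<Rightarrow> nat \<Rightarrow> nat set" where
  "colors_before i j = {x. x < i \<or> x = i \<and> i < j}"

definition relabel_inv :: "nat \<Rightarrow> nat \<Rightarrow> dcw \<Rightarrow> nat \<Rightarrow> nat \<Rightarrow> nat \<Rightarrow> nat \<Rightarrow> (nat \<Rightarrow> nat) \<Rightarrow> bool" where
  "relabel_inv r k X a b i j T \<longleftrightarrow>
     (\<forall>f < tsize r k. T f > 0 \<longleftrightarrow> (\<exists>c. relabel_fits r k X a b (colors_before i j) f c))"

text \<open>\<open>f'\<close> is \<open>f\<close> with the bit of \<open>(a, i)\<close> overwritten
  by that of \<open>(b, i)\<close>. Only vertices of label \<open>a\<close> and colour
  \<open>i\<close> look at this bit, and they thereby move to row \<open>b\<close>.\<close>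

lemma relabel_fits_insert:
  assumes X: "dcw_expression k X" and ab: "a \<in> {1..k}" "b \<in> {1..k}" and i: "i < r" "i \<notin> D"
    and f': "\<And>x. bit f' x \<longleftrightarrow> bit f (if x = pos r (a - 1) i then pos r (b - 1) i else x)"
  shows "relabel_fits r k X a b (insert i D) f c \<longleftrightarrow> relabel_fits r k X a b D f' c"
proof -
  let ?V = "pverts (dcw_graph X)"
  have wf: "k \<ge> 1" "parcs (dcw_graph X) \<subseteq> ?V \<times> ?V" using dcw_graph_wf[OF X] by blast+
  have lab: "dcw_label X v \<in> {1..k}" if "v \<in> ?V" for v using dcw_graph_wf(5)[OF X that] .
  have arcs: "arc r k f' x y \<longleftrightarrow> arc r k f x y" if "x < r" "y < r" for x y
    using that wf(1) ab i by (intro arc_cong) (auto simp: f' pos_eq_iff)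
  have 1: "bit f' (pos r ((if dcw_label X v = a \<and> c v \<in> D then b else dcw_label X v) - 1) (c v)) \<longleftrightarrow>
      bit f (pos r ((if dcw_label X v = a \<and> c v \<in> insert i D then b else dcw_label X v) - 1) (c v))"
    if "v \<in> ?V" "c v < r" for v
    using lab[OF that(1)] ab i that(2) by (auto simp: f' pos_eq_iff)
  have 3: "(\<forall>(u, v) \<in> parcs (dcw_graph X). arc r k f' (c u) (c v)) \<longleftrightarrow>
      (\<forall>(u, v) \<in> parcs (dcw_graph X). arc r k f (c u) (c v))" if "\<forall>v\<in>?V. c v < r"
  proof (rule ball_cong[OF refl])
    fix e assume "e \<in> parcs (dcw_graph X)"
    then obtain u v where "e = (u, v)" "u \<in> ?V" "v \<in> ?V" using wf(2) by auto
    then show "(case e of (u, v) \<Rightarrow> arc r k f' (c u) (c v)) =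
        (case e of (u, v) \<Rightarrow> arc r k f (c u) (c v))" using arcs that by simp
  qed
  show ?thesis unfolding relabel_fits_def using 1 3 by blast
qed

lemma relabel_inv_step:
  assumes X: "dcw_expression k X" and ab: "a \<in> {1..k}" "b \<in> {1..k}" and ij: "i < r" "j < r"
    and inv: "relabel_inv r k X a b i j T"
  shows "relabel_inv r k X a b i (Suc j) (entry r k 3 (a - 1) (b - 1) i j T T')"
proof (cases "i = j")
  case False
  then have "colors_before i (Suc j) = colors_before i j"
    "entry r k 3 (a - 1) (b - 1) i j T T' = T"
    by (auto simp: colors_before_def entry_def pass_val_def fun_eq_iff)
  then show ?thesis using inv by (simp add: relabel_inv_def)
next
  case True
  let ?p = "pos r (a - 1) i" and ?q = "pos r (b - 1) i"
  have D: "colors_before i (Suc j) = insert i (colors_before i j)" "i \<notin> colors_before i j"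
    using True by (auto simp: colors_before_def)
  have T: "T f > 0 \<longleftrightarrow> (\<exists>c. relabel_fits r k X a b (colors_before i j) f c)" if "f < tsize r k" for f
    using inv that by (auto simp: relabel_inv_def)
  show ?thesis unfolding relabel_inv_def
  proof (intro allI impI)
    fix f assume f: "f < tsize r k"
    \<comment> \<open>The index that the pass reads at \<open>f\<close>. Setting a bit inside the
      matrix does not leave the table.\<close>
    define f' where "f' = (if bit f ?p = bit f ?q then f
      else if bit f ?p then f - 2 ^ ?p else f + 2 ^ ?p)"
    have f'_less: "f' < tsize r k"
      using f ab ij plus_power_less_tsize[OF f, of "a - 1" i] by (auto simp: f'_def)
    have eq: "entry r k 3 (a - 1) (b - 1) i j T T' f = T f'"
      using f True by (auto simp: entry_def pass_val_def f'_def)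
    have bits: "bit f' x \<longleftrightarrow> bit f (if x = ?p then ?q else x)" for x
      by (auto simp: f'_def bit_diff_power bit_plus_power)
    show "entry r k 3 (a - 1) (b - 1) i j T T' f > 0 \<longleftrightarrow>
        (\<exists>c. relabel_fits r k X a b (colors_before i (Suc j)) f c)"
      unfolding D(1) relabel_fits_insert[OF X ab ij(1) D(2) bits] eq by (rule T[OF f'_less])
  qed
qed

lemma relabel_inv_next:
  assumes "i < r" "relabel_inv r k X a b i r T"
  shows "relabel_inv r k X a b (Suc i) 0 T"
proof -
  have "colors_before (Suc i) 0 = colors_before i r" using assms(1) by (auto simp: colors_before_def)
  then show ?thesis using assms by (simp add: relabel_inv_def)
qed

lemma relabel_inv_init:
  assumes "represents r k X T"
  shows "relabel_inv r k X a b 0 0 T"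
  using assms by (simp add: relabel_inv_def represents_def relabel_fits_def fits_def colors_before_def)

lemma relabel_inv_final:
  assumes "relabel_inv r k X a b r 0 T"
  shows "represents r k (Relabel a b X) T"
proof -
  have "relabel_fits r k X a b (colors_before r 0) f c \<longleftrightarrow> fits r k (Relabel a b X) f c" for f c
    by (auto simp: relabel_fits_def fits_def colors_before_def)
  then show ?thesis using assms by (simp add: relabel_inv_def represents_def)
qed

section \<open>Oriented colourings as homomorphisms into tournaments\<close>

lemma ex_bits: "\<exists>f < 2 ^ n. \<forall>x < n. bit (f::nat) x \<longleftrightarrow> A x"
proof -
  let ?f = "horner_sum of_bool 2 (map A [0..<n]) :: nat"
  have "bit ?f x \<longleftrightarrow> x < n \<and> A x" for x by (auto simp: bit_horner_sum_bit_iff)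
  then show ?thesis by (intro exI[of _ ?f]) (auto simp: less_power_iff_bit)
qed

text \<open>In an oriented colouring all arcs between two colours run the same way, and colours
  joined by no arc may be directed arbitrarily; this yields a tournament.\<close>

lemma oriented_coloring_iff_fits:
  assumes X: "dcw_expression k X"
  shows "(\<exists>c. oriented_coloring (dcw_graph X) r c) \<longleftrightarrow> (\<exists>f < tsize r k. \<exists>c. fits r k X f c)"
proof
  let ?V = "pverts (dcw_graph X)" and ?A = "parcs (dcw_graph X)"
  have arcs: "?A \<subseteq> ?V \<times> ?V" using dcw_graph_wf(4)[OF X] .
  have k: "k \<ge> 1" using dcw_graph_wf(3)[OF X] .
  {
    assume "\<exists>f < tsize r k. \<exists>c. fits r k X f c"
    then obtain f c where c: "fits r k X f c" by blast
    have "arc r k f (c u) (c v)" if "(u, v) \<in> ?A" for u v using c that by (auto simp: fits_def)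
    \<comment> \<open>The shift returns to colours 1 to \<open>r\<close>. Asymmetry of
      \<open>arc\<close> excludes arcs in both directions between two colours.\<close>
    then have "oriented_coloring (dcw_graph X) r (\<lambda>v. c v + 1)"
      using c unfolding oriented_coloring_def fits_def
      by (auto simp: Suc_le_eq dest: arc_irrefl) (metis arc_asym)
    then show "\<exists>c. oriented_coloring (dcw_graph X) r c" by blast
  next
    assume "\<exists>c. oriented_coloring (dcw_graph X) r c"
    then obtain c where c: "oriented_coloring (dcw_graph X) r c" ..
    \<comment> \<open>All label bits are set, so the labels restrict nothing; the second clause
      records the directions of the arcs between colours.\<close>
    define A where "A x \<longleftrightarrow> x < r * k \<or>
      (\<exists>(u, v) \<in> ?A. x = pos r (k - 1 + (c v - 1)) (c u - 1))" for x
    obtain f where f: "f < tsize r k" and bit: "\<And>x. x < r * (k - 1 + r) \<Longrightarrow> bit f x \<longleftrightarrow> A x"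
      using ex_bits[of "r * (k - 1 + r)" A] unfolding tsize_def by blast
    have cV: "1 \<le> c v" "c v - 1 < r" if "v \<in> ?V" for v
      using c that by (force simp: oriented_coloring_def)+
    have ne: "c u \<noteq> c v" if "(u, v) \<in> ?A" for u v using c that by (auto simp: oriented_coloring_def)
    have ne2: "c u \<noteq> c y" if "(u, v) \<in> ?A" "(x, y) \<in> ?A" "c v = c x" for u v x y
      using c that unfolding oriented_coloring_def by blast
    have labels: "bit f (pos r (dcw_label X v - 1) (c v - 1))" if v: "v \<in> ?V" for v
    proof -
      have l: "dcw_label X v - 1 < k" using dcw_graph_wf(5)[OF X v] by auto
      then have "pos r (dcw_label X v - 1) (c v - 1) < r * k" using cV[OF v] by (intro pos_less) auto
      moreover have "r * k \<le> r * (k - 1 + r)" using cV[OF v] k by (intro mult_le_mono2) linarith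
      ultimately show ?thesis using bit[OF less_le_trans] unfolding A_def by blast
    qed
    have "arc r k f (c u - 1) (c v - 1)" if uv: "(u, v) \<in> ?A" for u v
    proof -
      have V: "u \<in> ?V" "v \<in> ?V" using uv arcs by auto
      note cu = cV[OF V(1)] and cv = cV[OF V(2)]
      \<comment> \<open>As \<open>j\<close> is positive, this position lies beyond the label rows,
        so the first clause of \<open>A\<close> cannot set the bit.\<close>
      have bitA: "bit f (pos r (k - 1 + j) i) \<longleftrightarrow> (\<exists>(u, v) \<in> ?A. c v - 1 = j \<and> c u - 1 = i)"
        if "i < j" "j < r" for i j
      proof -
        have "pos r (k - 1 + j) i < r * (k - 1 + r)" using that by (intro pos_less) auto
        moreover have "r * k \<le> pos r (k - 1 + j) i"
        proof -
          have "k * r \<le> (k - 1 + j) * r" using that by (intro mult_le_mono1) linarith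
          then show ?thesis by (simp add: pos_def mult.commute trans_le_add1)
        qed
        moreover have "pos r (k - 1 + j) i = pos r (k - 1 + (c v - 1)) (c u - 1) \<longleftrightarrow>
            c v - 1 = j \<and> c u - 1 = i" if "(u, v) \<in> ?A" for u v
          using cV[of u] cV[of v] arcs that \<open>i < j\<close> \<open>j < r\<close> by (subst pos_eq_iff) auto
        ultimately show ?thesis by (subst bit) (auto simp: A_def)
      qed
      have "c u - 1 \<noteq> c v - 1" using ne[OF uv] cu cv by linarith
      moreover have "bit f (pos r (k - 1 + (c v - 1)) (c u - 1))" if "c u - 1 < c v - 1"
        using bitA[OF that cv(2)] uv by blast
      \<comment> \<open>A set bit would come from an arc running the opposite way between the same
        two colours, which the colouring forbids.\<close>
      moreover have "\<not> bit f (pos r (k - 1 + (c u - 1)) (c v - 1))" if less: "c v - 1 < c u - 1"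
      proof
        assume "bit f (pos r (k - 1 + (c u - 1)) (c v - 1))"
        then obtain x y where xy: "(x, y) \<in> ?A" "c y - 1 = c u - 1" "c x - 1 = c v - 1"
          using bitA[OF less cu(2)] by blast
        have "x \<in> ?V" "y \<in> ?V" using xy arcs by auto
        then have "c y = c u" "c x = c v" using xy cu cv cV[of x] cV[of y] by linarith+
        then show False using ne2[OF uv xy(1)] by simp
      qed
      ultimately show ?thesis by (simp add: arc_def)
    qed
    then have "fits r k X f (\<lambda>v. c v - 1)" using labels cV(2) unfolding fits_def by blast
    then show "\<exists>f < tsize r k. \<exists>c. fits r k X f c" using f by blast
  }
qed

section \<open>Evaluating the expression\<close>

text \<open>One iteration of \<open>eval_prog\<close> in continuation form. \<open>tb\<close> is the
  base of the table being written and \<open>sp\<close> its end, where a union finds its popped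
  operand. Fetching and the loop test fit between the factors 90 and 110.\<close>

lemma halts_within_operation:
  fixes R M :: "nat \<Rightarrow> nat"
  assumes env: "env r k R" and r: "r \<ge> 1"
    and pc: "R rPc = pc" "pc < R rFin"
    and code: "M pc = op" "M (Suc pc) = x" "M (Suc (Suc pc)) = y" "op \<le> 3"
    and sp: "sp = (if op = 0 then R rSp + tsize r k else if op = 1 then R rSp - tsize r k else R rSp)"
      "sp = tb + tsize r k"
    and a: "a = (if op = 0 then y else x) - 1" "a < k" and b: "b = y - 1" "b < k"
    and Inv_0: "Inv 0 0 (\<lambda>f. M (tb + f))"
    and Inv_step: "\<And>i j T. i < r \<Longrightarrow> j < r \<Longrightarrow> Inv i j T \<Longrightarrow>
      Inv i (Suc j) (entry r k op a b i j T (\<lambda>f. M (sp + f)))"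
    and Inv_next: "\<And>i T. i < r \<Longrightarrow> Inv i r T \<Longrightarrow> Inv (Suc i) 0 T"
    and Q: "\<And>R' M'. env r k R' \<Longrightarrow> R' rPc = pc + 3 \<Longrightarrow> R' rSp = sp \<Longrightarrow> R' rFin = R rFin \<Longrightarrow>
      R' rOut = R rOut \<Longrightarrow> (\<And>x. x < tb \<Longrightarrow> M' x = M x) \<Longrightarrow> Inv r 0 (\<lambda>f. M' (tb + f)) \<Longrightarrow>
      halts_within eval_prog (R', M') T Q"
  shows "halts_within eval_prog (R, M) (T + 110 * (r\<^sup>2 * tsize r k)) Q"
proof -
  note R = envD[OF env]
  let ?K = "r\<^sup>2 * tsize r k"
  have K: "1 \<le> ?K" using r tsize_ge_1[of r k] by simp
  define R1 where "R1 = fst (run fetch_prog (R, M))"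
  have run: "run fetch_prog (R, M) = (R1, M)"
    by (simp add: R1_def fetch_prog_def)
  have regs: "R1 rPc = pc + 3" "R1 rSp = sp" "R1 rA = a" "R1 rB = b" "R1 rOp = op"
    using R(1-3) R(7) pc(1) code
    by (simp_all add: R1_def fetch_prog_def sp(1) a(1) b(1))
  have tb: "R1 rTb = tb"
  proof -
    have "R1 rTb = R1 rSp - R1 rSiz" by (simp add: R1_def fetch_prog_def)
    moreover have "R1 rSiz = tsize r k" using R(7) by (simp add: R1_def fetch_prog_def)
    ultimately show ?thesis using regs(2) sp(2) by simp
  qed
  have same: "R1 x = R x" if "x < 6 \<or> 27 < x" for x
    using that by (auto simp: R1_def fetch_prog_def)
  note R1 = run regs tb same
  have env1: "env r k R1" using env by (simp add: env_def R1)
  have 1: "halts_within fetch_prog (R, M) 12 (\<lambda>s. s = (R1, M))"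
    by (rule halts_within_loop_free) (simp add: fetch_prog_def, simp add: fetch_prog_def, rule R1(1))
  have 2: "halts_within nest_prog (R1, M) (90 * ?K) (\<lambda>s. halts_within eval_prog s T Q)"
  proof (rule halts_within_nest_prog[OF env1 r R1(4,5) a(2) b(2) R1(6) code(4), where Inv = Inv])
    fix R' M'
    assume R': "\<And>x. x < 11 \<or> 26 < x \<Longrightarrow> R' x = R1 x"
      and M': "\<And>x. x < R1 rTb \<or> R1 rSp \<le> x \<Longrightarrow> M' x = M x" "Inv r 0 (\<lambda>f. M' (R1 rTb + f))"
    show "halts_within eval_prog (R', M') T Q"
      by (rule Q) (use env1 R' M' R1 in \<open>auto simp: env_def\<close>)
  qed (use sp R1 Inv_0 Inv_step Inv_next in simp_all)
  have "halts_within (Seq fetch_prog nest_prog) (R, M) (12 + 90 * ?K)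
      (\<lambda>s. halts_within eval_prog s T Q)"
    by (rule halts_within_Seq[OF 1 _ order_refl]) (use 2 in simp)
  then show ?thesis unfolding eval_prog_def
    by (rule halts_within_While_unfold[rotated]) (use K in linarith, use pc in simp)
qed

lemma length_dcw_code: "length (dcw_code X) = 3 * dcw_ops X"
  by (induction X) auto

lemma dcw_ops_ge_1: "dcw_ops X \<ge> 1"
  by (induction X) auto

text \<open>Evaluating \<open>X\<close> pushes one table and preserves all memory below it. Taking
  the rest of the run as a premise lets structural induction on \<open>X\<close> work over a single
  flat loop.\<close>

lemma halts_within_eval_prog:
  assumes "dcw_expression k X" "r \<ge> 1" "env r k R"
    and "pc + 3 * dcw_ops X \<le> R rFin" "R rFin \<le> R rSp" "R rPc = pc"
    and "\<And>x. x < 3 * dcw_ops X \<Longrightarrow> M (pc + x) = dcw_code X ! x"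
    and "\<And>R' M'. env r k R' \<Longrightarrow> R' rPc = pc + 3 * dcw_ops X \<Longrightarrow> R' rSp = R rSp + tsize r k \<Longrightarrow>
      R' rFin = R rFin \<Longrightarrow> R' rOut = R rOut \<Longrightarrow> (\<And>x. x < R rSp \<Longrightarrow> M' x = M x) \<Longrightarrow>
      represents r k X (\<lambda>f. M' (R rSp + f)) \<Longrightarrow> halts_within eval_prog (R', M') T Q"
  shows "halts_within eval_prog (R, M) (T + dcw_ops X * (110 * (r\<^sup>2 * tsize r k))) Q"
  using assms
proof (induction X arbitrary: R M pc T)
  case (Create v a)
  note prems = Create.prems
  have code: "M pc = 0" "M (Suc pc) = v" "M (Suc (Suc pc)) = a"
    using prems(7)[of 0] prems(7)[of 1] prems(7)[of 2] by auto
  have "halts_within eval_prog (R, M) (T + 110 * (r\<^sup>2 * tsize r k)) Q"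
  proof (rule halts_within_operation[OF prems(3) prems(2,6) _ code, where
        Inv = "create_inv r k (a - 1)" and a = "a - 1" and b = "a - 1"])
    show "create_inv r k (a - 1) i (Suc j) (entry r k 0 (a - 1) (a - 1) i j T' T'')"
      if "j < r" "create_inv r k (a - 1) i j T'" for i j T' T''
      using create_inv_step that .
    fix R' M'
    assume *: "env r k R'" "R' rPc = pc + 3" "R' rSp = R rSp + tsize r k" "R' rFin = R rFin"
      "R' rOut = R rOut" "\<And>x. x < R rSp \<Longrightarrow> M' x = M x"
      "create_inv r k (a - 1) r 0 (\<lambda>f. M' (R rSp + f))"
    show "halts_within eval_prog (R', M') T Q"
      by (rule prems(8)) (use * prems(2) in \<open>auto intro!: create_inv_final\<close>)
  next
    show "create_inv r k (a - 1) (Suc i) 0 T'" if "create_inv r k (a - 1) i r T'" for i T'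
      using create_inv_next[OF prems(2) that] .
  qed (use prems(1,4) in \<open>auto simp: create_inv_def\<close>)
  then show ?case by simp
next
  case (Disj X Y)
  note prems = Disj.prems
  let ?K = "110 * (r\<^sup>2 * tsize r k)" and ?S = "tsize r k"
  have X: "dcw_expression k X" and Y: "dcw_expression k Y" using prems(1) by auto
  have k: "k \<ge> 1" using dcw_graph_wf(3)[OF X] .
  have cX: "M (pc + x) = dcw_code X ! x" if "x < 3 * dcw_ops X" for x
    using prems(7)[of x] that by (simp add: nth_append length_dcw_code)
  have cY: "M (pc + 3 * dcw_ops X + x) = dcw_code Y ! x" if "x < 3 * dcw_ops Y" for x
    using prems(7)[of "3 * dcw_ops X + x"] that by (simp add: nth_append length_dcw_code add.assoc)
  let ?pc = "pc + 3 * dcw_ops X + 3 * dcw_ops Y"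
  have code: "M ?pc = 1" "M (Suc ?pc) = 0" "M (Suc (Suc ?pc)) = 0"
    using prems(7)[of "3 * dcw_ops X + 3 * dcw_ops Y"]
      prems(7)[of "3 * dcw_ops X + 3 * dcw_ops Y + 1"]
      prems(7)[of "3 * dcw_ops X + 3 * dcw_ops Y + 2"]
    by (simp_all add: nth_append length_dcw_code add.assoc)
  have "halts_within eval_prog (R, M) (((T + ?K) + dcw_ops Y * ?K) + dcw_ops X * ?K) Q"
  proof (rule Disj.IH(1)[OF X prems(2,3) _ prems(5,6) cX])
    fix R1 M1
    assume R1: "env r k R1" "R1 rPc = pc + 3 * dcw_ops X" "R1 rSp = R rSp + ?S" "R1 rFin = R rFin"
      "R1 rOut = R rOut" and M1: "\<And>x. x < R rSp \<Longrightarrow> M1 x = M x"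
      and T1: "represents r k X (\<lambda>f. M1 (R rSp + f))"
    show "halts_within eval_prog (R1, M1) ((T + ?K) + dcw_ops Y * ?K) Q"
    proof (rule Disj.IH(2)[OF Y prems(2) R1(1) _ _ R1(2)])
      show "M1 (pc + 3 * dcw_ops X + x) = dcw_code Y ! x" if "x < 3 * dcw_ops Y" for x
        using cY[OF that] prems(4,5) that by (subst M1) auto
      fix R2 M2
      assume R2: "env r k R2" "R2 rPc = ?pc" "R2 rSp = R1 rSp + ?S" "R2 rFin = R1 rFin"
        "R2 rOut = R1 rOut" and M2: "\<And>x. x < R1 rSp \<Longrightarrow> M2 x = M1 x"
        and T2: "represents r k Y (\<lambda>f. M2 (R1 rSp + f))"
      have M2_eq: "M2 x = M x" if "x < R rSp" for x using M1[OF that] M2[of x] R1(3) that by simp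
      \<comment> \<open>The code lies below \<open>rFin\<close>, hence below the stack, and survives
        both evaluations.\<close>
      have code2: "M2 ?pc = 1" "M2 (Suc ?pc) = 0" "M2 (Suc (Suc ?pc)) = 0"
        using code prems(4,5) by (simp_all add: M2_eq)
      show "halts_within eval_prog (R2, M2) (T + ?K) Q"
      \<comment> \<open>A union carries dummy operands 0; truncated subtraction maps them to row 0,
        which exists because \<open>k \<ge> 1\<close>.\<close>
      proof (rule halts_within_operation[OF R2(1) prems(2) R2(2) _ code2, where
            Inv = "disj_inv r k (\<lambda>f. M2 (R rSp + f)) (\<lambda>f. M2 (R1 rSp + f))" and a = 0 and b = 0
            and sp = "R1 rSp" and tb = "R rSp"])
        fix R3 M3
        assume R3: "env r k R3" "R3 rPc = ?pc + 3" "R3 rSp = R1 rSp" "R3 rFin = R2 rFin"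
          "R3 rOut = R2 rOut" and M3: "\<And>x. x < R rSp \<Longrightarrow> M3 x = M2 x"
          and inv: "disj_inv r k (\<lambda>f. M2 (R rSp + f)) (\<lambda>f. M2 (R1 rSp + f)) r 0
            (\<lambda>f. M3 (R rSp + f))"
        have "represents r k (Disj X Y) (\<lambda>f. M3 (R rSp + f))"
          using T1 T2 inv prems(2) M2 R1(3)
          by (simp add: represents_def disj_inv_def fits_Disj[OF prems(1)])
        then show "halts_within eval_prog (R3, M3) T Q"
          using R1 R2 R3 M3 M2_eq by (intro prems(8)) auto
      next
        let ?Inv = "disj_inv r k (\<lambda>f. M2 (R rSp + f)) (\<lambda>f. M2 (R1 rSp + f))"
        show "?Inv 0 0 (\<lambda>f. M2 (R rSp + f))"
          by (simp add: disj_inv_def)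
        show "?Inv i (Suc j) (entry r k 1 0 0 i j T' (\<lambda>f. M2 (R1 rSp + f)))" if "?Inv i j T'" for i j T'
          using disj_inv_step[OF that] .
        show "?Inv (Suc i) 0 T'" if "?Inv i r T'" for i T'
          using disj_inv_next[OF prems(2) that] .
      qed (use R1 R2 prems(4) k in auto)
    qed (use R1 prems(4,5) in auto)
  qed (use prems(4) in auto)
  then show ?case by (simp add: algebra_simps)
next
  case (Insert_Arcs a b X)
  note prems = Insert_Arcs.prems
  let ?K = "110 * (r\<^sup>2 * tsize r k)" and ?S = "tsize r k"
  have X: "dcw_expression k X" and ab: "a \<in> {1..k}" "b \<in> {1..k}" using prems(1) by auto
  have cX: "M (pc + x) = dcw_code X ! x" if "x < 3 * dcw_ops X" for x
    using prems(7)[of x] that by (simp add: nth_append length_dcw_code)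
  let ?pc = "pc + 3 * dcw_ops X"
  have code: "M ?pc = 2" "M (Suc ?pc) = a" "M (Suc (Suc ?pc)) = b"
    using prems(7)[of "3 * dcw_ops X"] prems(7)[of "3 * dcw_ops X + 1"]
      prems(7)[of "3 * dcw_ops X + 2"]
    by (simp_all add: nth_append length_dcw_code)
  have "halts_within eval_prog (R, M) ((T + ?K) + dcw_ops X * ?K) Q"
  proof (rule Insert_Arcs.IH[OF X prems(2,3) _ prems(5,6) cX])
    fix R1 M1
    assume R1: "env r k R1" "R1 rPc = ?pc" "R1 rSp = R rSp + ?S" "R1 rFin = R rFin"
      "R1 rOut = R rOut" and M1: "\<And>x. x < R rSp \<Longrightarrow> M1 x = M x"
      and T1: "represents r k X (\<lambda>f. M1 (R rSp + f))"
    have code1: "M1 ?pc = 2" "M1 (Suc ?pc) = a" "M1 (Suc (Suc ?pc)) = b"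
      using code prems(4,5) by (simp_all add: M1)
    show "halts_within eval_prog (R1, M1) (T + ?K) Q"
    proof (rule halts_within_operation[OF R1(1) prems(2) R1(2) _ code1, where
          Inv = "insert_inv r k X a b" and a = "a - 1" and b = "b - 1"
          and sp = "R1 rSp" and tb = "R rSp"])
      fix R3 M3
      assume R3: "env r k R3" "R3 rPc = ?pc + 3" "R3 rSp = R1 rSp" "R3 rFin = R1 rFin"
        "R3 rOut = R1 rOut" and M3: "\<And>x. x < R rSp \<Longrightarrow> M3 x = M1 x"
        and inv: "insert_inv r k X a b r 0 (\<lambda>f. M3 (R rSp + f))"
      show "halts_within eval_prog (R3, M3) T Q"
        using R1 R3 M3 M1 insert_inv_final[OF inv] by (intro prems(8)) auto
    next
      show "insert_inv r k X a b i (Suc j) (entry r k 2 (a - 1) (b - 1) i j T' (\<lambda>f. M1 (R1 rSp + f)))"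
        if "i < r" "j < r" "insert_inv r k X a b i j T'" for i j T'
        using insert_inv_step[OF X ab that] .
    next
      show "insert_inv r k X a b (Suc i) 0 T'" if "insert_inv r k X a b i r T'" for i T'
        using insert_inv_next[OF that] .
    qed (use R1 prems(4) ab insert_inv_init[OF T1] in auto)
  qed (use prems(4) in auto)
  then show ?case by (simp add: algebra_simps)
next
  case (Relabel a b X)
  note prems = Relabel.prems
  let ?K = "110 * (r\<^sup>2 * tsize r k)" and ?S = "tsize r k"
  have X: "dcw_expression k X" and ab: "a \<in> {1..k}" "b \<in> {1..k}" using prems(1) by auto
  have cX: "M (pc + x) = dcw_code X ! x" if "x < 3 * dcw_ops X" for x
    using prems(7)[of x] that by (simp add: nth_append length_dcw_code)
  let ?pc = "pc + 3 * dcw_ops X"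
  have code: "M ?pc = 3" "M (Suc ?pc) = a" "M (Suc (Suc ?pc)) = b"
    using prems(7)[of "3 * dcw_ops X"] prems(7)[of "3 * dcw_ops X + 1"]
      prems(7)[of "3 * dcw_ops X + 2"]
    by (simp_all add: nth_append length_dcw_code)
  have "halts_within eval_prog (R, M) ((T + ?K) + dcw_ops X * ?K) Q"
  proof (rule Relabel.IH[OF X prems(2,3) _ prems(5,6) cX])
    fix R1 M1
    assume R1: "env r k R1" "R1 rPc = ?pc" "R1 rSp = R rSp + ?S" "R1 rFin = R rFin"
      "R1 rOut = R rOut" and M1: "\<And>x. x < R rSp \<Longrightarrow> M1 x = M x"
      and T1: "represents r k X (\<lambda>f. M1 (R rSp + f))"
    have code1: "M1 ?pc = 3" "M1 (Suc ?pc) = a" "M1 (Suc (Suc ?pc)) = b"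
      using code prems(4,5) by (simp_all add: M1)
    show "halts_within eval_prog (R1, M1) (T + ?K) Q"
    proof (rule halts_within_operation[OF R1(1) prems(2) R1(2) _ code1, where
          Inv = "relabel_inv r k X a b" and a = "a - 1" and b = "b - 1"
          and sp = "R1 rSp" and tb = "R rSp"])
      fix R3 M3
      assume R3: "env r k R3" "R3 rPc = ?pc + 3" "R3 rSp = R1 rSp" "R3 rFin = R1 rFin"
        "R3 rOut = R1 rOut" and M3: "\<And>x. x < R rSp \<Longrightarrow> M3 x = M1 x"
        and inv: "relabel_inv r k X a b r 0 (\<lambda>f. M3 (R rSp + f))"
      show "halts_within eval_prog (R3, M3) T Q"
        using R1 R3 M3 M1 relabel_inv_final[OF inv] by (intro prems(8)) auto
    next
      show "relabel_inv r k X a b i (Suc j) (entry r k 3 (a - 1) (b - 1) i j T' (\<lambda>f. M1 (R1 rSp + f)))"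
        if "i < r" "j < r" "relabel_inv r k X a b i j T'" for i j T'
        using relabel_inv_step[OF X ab that] .
    next
      show "relabel_inv r k X a b (Suc i) 0 T'" if "i < r" "relabel_inv r k X a b i r T'" for i T'
        using relabel_inv_next[OF that] .
    qed (use R1 prems(4) ab relabel_inv_init[OF T1] in auto)
  qed (use prems(4) in auto)
  then show ?case by (simp add: algebra_simps)
qed

section \<open>Setup, final scan and total running time\<close>

text \<open>The stack starts right after the input, which has three header cells and three cells per
  operation. The table size is the power of two at row \<open>k - 1 + r\<close> and column
  0.\<close>

lemma halts_within_setup_prog:
  assumes "M 0 = r" "M 1 = k" "M 2 = N" "r \<ge> 1"
    and Q: "\<And>R. env r k R \<Longrightarrow> R rPc = 3 \<Longrightarrow> R rFin = 3 + 3 * N \<Longrightarrow> R rSp = 3 + 3 * N \<Longrightarrow>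
      R rOut = 0 \<Longrightarrow> Q (R, M)"
  shows "halts_within setup_prog (\<lambda>_. 0, M) (20 * tsize r k) Q"
proof -
  let ?P = "block
     [Const rOne 1, Const rTwo 2, Const rThree 3, Load rCol rZero, Load rLab rOne, Load rFin rTwo,
      Add rPc rFin rFin, Add rFin rFin rPc, Add rFin rFin rThree, Add rPc rThree rZero,
      Add rSp rFin rZero, Sub rLab rLab rOne, Add rRow rLab rCol, Const rVb 0]"
  define R where "R = fst (run ?P (\<lambda>_. 0, M))"
  have run: "run ?P (\<lambda>_. 0, M) = (R, M)" by (simp add: R_def)
  have R: "R rOne = 1" "R rZero = 0" "R rTwo = 2" "R rThree = 3" "R rCol = r" "R rLab = k - 1"
    "R rPc = 3" "R rFin = 3 + 3 * N" "R rSp = 3 + 3 * N" "R rOut = 0" "R rRow = k - 1 + r" "R rVb = 0"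
    using assms(1-3) by (simp_all add: R_def)
  have "halts_within setup_prog (\<lambda>_. 0, M) (14 + 6 * tsize r k) Q"
    unfolding setup_prog_def
  proof (rule halts_within_Seq[OF _ _ order_refl])
    show "halts_within ?P (\<lambda>_. 0, M) 14 (\<lambda>s. s = (R, M))"
      by (rule halts_within_loop_free) (simp, simp, rule run)
    show "halts_within (power_prog rSiz rRow rVb) s (6 * tsize r k) Q" if "s = (R, M)" for s
      unfolding that tsize_def
      by (rule halts_within_power_prog, use R assms(4) in \<open>simp_all add: mult.commute\<close>)
        (rule Q; use R in \<open>simp add: env_def tsize_def mult.commute\<close>)
  qed
  then show ?thesis by (rule halts_within_mono) (use tsize_ge_1[of r k] in auto)
qed

lemma halts_within_scan_prog:
  assumes env: "env r k R" and sp: "R rSp = tb + tsize r k" and out: "R rOut = 0"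
  shows "halts_within scan_prog (R, M) (9 * tsize r k)
    (\<lambda>s. ram_output s = (if \<exists>f < tsize r k. M (tb + f) > 0 then 1 else 0))"
proof -
  note R = envD[OF env]
  let ?S = "tsize r k"
  define I where "I f s \<longleftrightarrow> (\<forall>x. 27 < x \<or> x = rSiz \<longrightarrow> fst s x = R x) \<and> fst s rTb = tb \<and>
    snd s = M \<and> fst s rF = f \<and> fst s rOut = (if \<exists>x < f. M (tb + x) > 0 then 1 else 0)"
    for f and s :: ram_state
  have body: "halts_within (block [Add rAd rTb rF, Load rAd rAd, If_Less rZero rAd (Const rOut 1) Skip,
         Add rF rF rOne]) s 5 (I (Suc f))" if "I f s" for f s
    by (rule halts_within_loop_free; cases s)
      (use that R in \<open>auto simp: I_def less_Suc_eq\<close>)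
  have "halts_within scan_prog (R, M) (2 + (?S * (5 + 1) + 1))
      (\<lambda>s. ram_output s = (if \<exists>f < ?S. M (tb + f) > 0 then 1 else 0))"
    unfolding scan_prog_def
  proof (rule halts_within_Seq[OF _ _ order_refl])
    show "halts_within (Seq (Sub rTb rSp rSiz) (Const rF 0)) (R, M) 2 (I 0)"
      by (rule halts_within_loop_free) (use R sp out in \<open>auto simp: I_def\<close>)
    show "halts_within (While_Less rF rSiz
       (block [Add rAd rTb rF, Load rAd rAd, If_Less rZero rAd (Const rOut 1) Skip,
         Add rF rF rOne])) s (?S * (5 + 1) + 1)
      (\<lambda>s. ram_output s = (if \<exists>f < ?S. M (tb + f) > 0 then 1 else 0))" if "I 0 s" for s
      by (rule halts_within_While[where I = I and N = ?S, OF that _ body])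
        (use R in \<open>auto simp: I_def ram_output_def\<close>)
  qed
  then show ?thesis by (rule halts_within_mono) (use tsize_ge_1[of r k] in auto)
qed

lemma halts_within_coloring_prog:
  assumes X: "dcw_expression k X" and r: "r \<ge> 1"
  shows "halts_within coloring_prog (ram_input (instance_code r k X))
    (140 * (dcw_ops X * (r\<^sup>2 * tsize r k)))
    (\<lambda>s. ram_output s = (if \<exists>c. oriented_coloring (dcw_graph X) r c then 1 else 0))"
    (is "halts_within _ _ _ ?Q")
proof -
  let ?S = "tsize r k" and ?N = "dcw_ops X"
  let ?K = "110 * (r\<^sup>2 * ?S)"
  define M where "M = snd (ram_input (instance_code r k X))"
  have input: "ram_input (instance_code r k X) = (\<lambda>_. 0, M)" by (simp add: M_def ram_input_def)
  have M: "M 0 = r" "M 1 = k" "M 2 = ?N"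
    by (simp_all add: M_def ram_input_def instance_code_def)
  have code: "M (3 + x) = dcw_code X ! x" if "x < 3 * ?N" for x
    using that by (simp add: M_def ram_input_def instance_code_def length_dcw_code)
  have "halts_within coloring_prog (\<lambda>_. 0, M) (20 * ?S + ((1 + ?N * ?K) + 9 * ?S)) ?Q"
    unfolding coloring_prog_def block.simps
  proof (rule halts_within_Seq[where Q' = "\<lambda>s. halts_within (Seq eval_prog scan_prog) s
        ((1 + ?N * ?K) + 9 * ?S) ?Q", OF _ _ order_refl])
    show "halts_within setup_prog (\<lambda>_. 0, M) (20 * ?S) (\<lambda>s. halts_within (Seq eval_prog scan_prog) s
        ((1 + ?N * ?K) + 9 * ?S) ?Q)"
    proof (rule halts_within_setup_prog[OF M r])
      fix R
      assume R: "env r k R" "R rPc = 3" "R rFin = 3 + 3 * ?N" "R rSp = 3 + 3 * ?N" "R rOut = 0"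
      have "halts_within eval_prog (R, M) (1 + ?N * ?K) (\<lambda>s. halts_within scan_prog s (9 * ?S) ?Q)"
      proof (rule halts_within_eval_prog[OF X r R(1) _ _ R(2) code])
        fix R' M'
        assume R': "env r k R'" "R' rPc = 3 + 3 * ?N" "R' rSp = R rSp + ?S" "R' rFin = R rFin"
          "R' rOut = R rOut" and T: "represents r k X (\<lambda>f. M' (R rSp + f))"
        \<comment> \<open>All code has been read, so the continuation consists of one failing loop
          test.\<close>
        have "ram_exec eval_prog (R', M') 1 (R', M')"
          unfolding eval_prog_def using R R' by (intro ram_exec.While_False) simp
        moreover have "halts_within scan_prog (R', M') (9 * ?S) ?Q"
          by (rule halts_within_mono[OF halts_within_scan_prog[OF R'(1,3)] order_refl])
            (use T R R' oriented_coloring_iff_fits[OF X] in \<open>auto simp: represents_def\<close>)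
        ultimately show "halts_within eval_prog (R', M') 1 (\<lambda>s. halts_within scan_prog s (9 * ?S) ?Q)"
          unfolding halts_within_def[of eval_prog] by blast
      qed (use R in auto)
      then show "halts_within (Seq eval_prog scan_prog) (R, M) ((1 + ?N * ?K) + 9 * ?S) ?Q"
        by (rule halts_within_Seq) auto
    qed
  qed
  moreover have "20 * ?S + ((1 + ?N * ?K) + 9 * ?S) \<le> 140 * (?N * (r\<^sup>2 * ?S))"
  proof -
    have "1 * (1 * ?S) \<le> ?N * (r\<^sup>2 * ?S)"
      using dcw_ops_ge_1[of X] r by (intro mult_le_mono) auto
    moreover have "?N * ?K = 110 * (?N * (r\<^sup>2 * ?S))" by simp
    ultimately show ?thesis using tsize_ge_1[of r k] by linarith
  qed
  ultimately show ?thesis unfolding input by (rule halts_within_mono) auto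
qed

lemma square_le_double_power: "(r::nat)\<^sup>2 \<le> 2 * 2 ^ r"
proof (induction r)
  case (Suc r)
  \<comment> \<open>The square grows by \<open>2 * r + 1\<close>, which is at most the growth
    \<open>2 * 2 ^ r\<close> of the right-hand side.\<close>
  have "r + 1 \<le> 2 ^ r" by (simp add: Suc_leI)
  then show ?case using Suc by (simp add: power2_eq_square)
qed simp

text \<open>The \<open>r ^ 2\<close> passes are absorbed, up to a factor 2, by the row of
  \<open>r\<close> bits that the index saves.\<close>

lemma square_times_tsize_le:
  assumes "k \<ge> 1"
  shows "r\<^sup>2 * tsize r k \<le> 2 * 2 ^ (r * (r + k))"
proof -
  have "r * (k - 1 + r) + r = r * (r + k)" using assms by (cases k) (auto simp: algebra_simps)
  then have "2 ^ r * tsize r k = 2 ^ (r * (r + k))"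
    unfolding tsize_def power_add[symmetric] by (simp add: add.commute)
  moreover have "r\<^sup>2 * tsize r k \<le> (2 * 2 ^ r) * tsize r k"
    using square_le_double_power by (intro mult_le_mono1)
  ultimately show ?thesis by (simp add: mult.assoc)
qed

text \<open>Redundant operations can make an expression arbitrarily long, while the bound speaks
  only of \<open>n\<close>, \<open>k\<close> and \<open>r\<close>. Its length is therefore measured
  by a factor \<open>d\<close>, on which the constant depends but the program does not.\<close>

theorem theorem6p11:
  shows "\<exists>P :: ram. \<forall>d :: nat. \<exists>C :: nat.
    \<forall>(G :: nat pair_pre_digraph) (X :: dcw) (n :: nat) (k :: nat) (r :: nat).
      oriented_graph G \<longrightarrow> card (pverts G) = n \<longrightarrow>
      dcw_expression k X \<longrightarrow> dcw_graph X = G \<longrightarrow> dcw_ops X \<le> d * (n * k ^ 2) \<longrightarrow>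
      r \<ge> 1 \<longrightarrow>
      (\<exists>t s. ram_exec P (ram_input (instance_code r k X)) t s \<and>
         t \<le> C * (n * k ^ 2 * 2 ^ (r * (r + k))) \<and>
         ram_output s = (if \<exists>c. oriented_coloring G r c then 1 else 0))"
proof (rule exI[of _ coloring_prog], rule allI, rename_tac d, rule_tac x = "280 * d" in exI,
    intro allI impI)
  fix d n k r :: nat and G :: "nat pair_pre_digraph" and X
  assume X: "dcw_expression k X" and G: "dcw_graph X = G" and r: "1 \<le> r"
    and ops: "dcw_ops X \<le> d * (n * k ^ 2)"
  \<comment> \<open>The constant is 140 from the program, 2 from the estimate of
    \<open>r ^ 2\<close>, and \<open>d\<close> from the length of the expression.\<close>
  have "140 * (dcw_ops X * (r\<^sup>2 * tsize r k)) \<le> 140 * (d * (n * k ^ 2) * (2 * 2 ^ (r * (r + k))))"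
    by (rule mult_le_mono2, rule mult_le_mono[OF ops square_times_tsize_le[OF dcw_graph_wf(3)[OF X]]])
  also have "\<dots> = 280 * d * (n * k ^ 2 * 2 ^ (r * (r + k)))" by simp
  finally show "\<exists>t s. ram_exec coloring_prog (ram_input (instance_code r k X)) t s \<and>
         t \<le> 280 * d * (n * k ^ 2 * 2 ^ (r * (r + k))) \<and>
         ram_output s = (if \<exists>c. oriented_coloring G r c then 1 else 0)"
    using halts_within_coloring_prog[OF X r] unfolding halts_within_def G by (meson le_trans)
qed

end
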